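(* Let $n>m\ge 2$ be integers and let $K=K(n,m,\Lambda)\subset\mathbb{R}^2$ be a Bedford-McMullen carpet that is not contained in any line. If $f:\mathbb{R}^2\to\mathbb{R}^2$ is a similitude with $f(K)\subset K$, then $f$ is not oblique.
   Context: Bedford-McMullen carpet: let $n>m\ge 2$ be integers and $\Lambda\subset\{0,\dots,n-1\}\times\{0,\dots,m-1\}$ with $1<\#\Lambda<mn$ (this cardinality condition is always assumed). Put $\varphi_{i,j}(x,y)=\left(\frac{x+i}{n},\frac{y+j}{m}\right)$ for $(i,j)\in\Lambda$. Then $K(n,m,\Lambda)$ is the attractor of $\{\varphi_{i,j}\}_{(i,j)\in\Lambda}$, i.e. $K(n,m,\Lambda)=\left\{\left(\sum_{k\ge1} i_k n^{-k},\sum_{k\ge1} j_k m^{-k}\right):(i_k,j_k)\in\Lambda\text{ for all }k\right\}$. Similitude: a map $f(x)=\lambda Ox+a$ on $\mathbb{R}^2$ with $\lambda\ge0$ (similarity ratio), $O$ an orthogonal transformation of $\mathbb{R}^2$, $a\in\mathbb{R}^2$. Obliqueness: a line in $\mathbb{R}^2$ is oblique if it is not parallel to either coordinate axis. A similitude $f$ of $\mathbb{R}^2$ with positive similarity ratio is oblique if $f$ sends the $x$-axis to an oblique line. *)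

theory Defs
  imports "HOL-Analysis.Analysis"
begin

definition ifs_attractor :: "('a::metric_space \<Rightarrow> 'a) set \<Rightarrow> 'a set" where
  "ifs_attractor F = (THE K. compact K \<and> K \<noteq> {} \<and> K = (\<Union>f\<in>F. f ` K))"

definition carpet_map :: "nat \<Rightarrow> nat \<Rightarrow> nat \<times> nat \<Rightarrow> real \<times> real \<Rightarrow> real \<times> real" where
  "carpet_map n m d p = ((fst p + real (fst d)) / real n, (snd p + real (snd d)) / real m)"

text \<open>The description as \<open>THE\<close> attractor is meaningful: \<open>carpet_attractor_unique\<close> below shows
  existence and uniqueness, and \<open>carpet_eq_digits\<close> gives the digit expansion.\<close>

definition carpet :: "nat \<Rightarrow> nat \<Rightarrow> (nat \<times> nat) set \<Rightarrow> (real \<times> real) set" where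
  "carpet n m \<Lambda> = ifs_attractor (carpet_map n m ` \<Lambda>)"

definition is_line :: "'a::euclidean_space set \<Rightarrow> bool" where
  "is_line L \<longleftrightarrow> affine L \<and> aff_dim L = 1"

definition x_axis :: "(real \<times> real) set" where
  "x_axis = {p. snd p = 0}"

definition y_axis :: "(real \<times> real) set" where
  "y_axis = {p. fst p = 0}"

definition oblique_line :: "(real \<times> real) set \<Rightarrow> bool" where
  "oblique_line L \<longleftrightarrow> is_line L \<and> \<not> affine_parallel L x_axis \<and> \<not> affine_parallel L y_axis"

definition similitude_with_ratio :: "real \<Rightarrow> ('a::euclidean_space \<Rightarrow> 'a) \<Rightarrow> bool" where
  "similitude_with_ratio r f \<longleftrightarrow>
     r \<ge> 0 \<and> (\<exists>T a. orthogonal_transformation T \<and> (\<forall>x. f x = r *\<^sub>R T x + a))"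

definition similitude :: "('a::euclidean_space \<Rightarrow> 'a) \<Rightarrow> bool" where
  "similitude f \<longleftrightarrow> (\<exists>r. similitude_with_ratio r f)"

definition oblique_similitude :: "(real \<times> real \<Rightarrow> real \<times> real) \<Rightarrow> bool" where
  "oblique_similitude f \<longleftrightarrow> (\<exists>r>0. similitude_with_ratio r f) \<and> oblique_line (f ` x_axis)"

definition digit_point :: "nat \<Rightarrow> nat \<Rightarrow> (nat \<Rightarrow> nat \<times> nat) \<Rightarrow> real \<times> real" where
  "digit_point n m d =
     (\<Sum>k. real (fst (d k)) / real n ^ Suc k, \<Sum>k. real (snd (d k)) / real m ^ Suc k)"

context
  fixes n m :: nat and \<Lambda> :: "(nat \<times> nat) set"
  assumes n2: "n \<ge> 2" and m2: "m \<ge> 2"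
    and digits: "\<Lambda> \<subseteq> {0..<n} \<times> {0..<m}" and nonempty: "\<Lambda> \<noteq> {}"
begin

private definition tail_map :: "nat \<Rightarrow> (nat \<Rightarrow> nat \<times> nat) \<Rightarrow> real \<times> real \<Rightarrow> real \<times> real" where
  "tail_map k d p =
     ((\<Sum>j<k. real (fst (d j)) / real n ^ Suc j) + fst p / real n ^ k,
      (\<Sum>j<k. real (snd (d j)) / real m ^ Suc j) + snd p / real m ^ k)"

private lemma tail_map_Suc: "tail_map (Suc k) d p = tail_map k d (carpet_map n m (d k) p)"
  using n2 m2 by (simp add: tail_map_def carpet_map_def field_simps)

private lemma digit_le:
  assumes "b \<ge> 2" "a < (b::nat)"
  shows "real a / real b ^ Suc k \<le> (1/2) ^ k"
proof -
  have "real a / real b ^ Suc k \<le> real b / real b ^ Suc k"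
    using assms by (intro divide_right_mono) auto
  also have "\<dots> = (1 / real b) ^ k" using assms by (simp add: power_divide)
  also have "\<dots> \<le> (1/2) ^ k" using assms by (intro power_mono) (auto simp: field_simps)
  finally show ?thesis .
qed

private lemma fst_le: "d \<in> \<Lambda> \<Longrightarrow> real (fst d) / real n ^ Suc k \<le> (1/2) ^ k"
  using digits n2 by (intro digit_le) auto

private lemma snd_le: "d \<in> \<Lambda> \<Longrightarrow> real (snd d) / real m ^ Suc k \<le> (1/2) ^ k"
  using digits m2 by (intro digit_le) auto

private lemma half_summable: "summable (\<lambda>k. (1/2::real) ^ k)"
  by (rule summable_geometric) simp

private lemma summable_digits:
  assumes "\<And>k. d k \<in> \<Lambda>"
  shows "summable (\<lambda>k. real (fst (d k)) / real n ^ Suc k)"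
    and "summable (\<lambda>k. real (snd (d k)) / real m ^ Suc k)"
  by (rule summable_comparison_test'[OF half_summable, of 0];
      use fst_le[OF assms] snd_le[OF assms] in simp)+

private lemma power_to_0:
  assumes "b \<ge> 2" "\<And>k. \<bar>x k\<bar> \<le> B"
  shows "(\<lambda>k. x k / real b ^ k) \<longlonglongrightarrow> 0"
proof (rule Lim_null_comparison)
  show "\<forall>\<^sub>F k in sequentially. norm (x k / real b ^ k) \<le> B * inverse (real b) ^ k"
    using assms(2) by (intro always_eventually allI)
      (simp add: power_inverse divide_inverse abs_mult mult_right_mono)
  have "(\<lambda>k. inverse (real b) ^ k) \<longlonglongrightarrow> 0"
    using assms by (intro LIMSEQ_power_zero) (auto simp: field_simps)
  then show "(\<lambda>k. B * inverse (real b) ^ k) \<longlonglongrightarrow> 0"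
    by (rule tendsto_mult_right_zero)
qed

private lemma tail_map_tendsto:
  assumes d: "\<And>k. d k \<in> \<Lambda>" and p: "\<And>k. p k \<in> K" and K: "bounded K"
  shows "(\<lambda>k. tail_map k d (p k)) \<longlonglongrightarrow> digit_point n m d"
proof -
  from K obtain B where B: "\<And>x. x \<in> K \<Longrightarrow> norm x \<le> B" by (auto simp: bounded_iff)
  have "\<bar>fst (p k)\<bar> \<le> B" "\<bar>snd (p k)\<bar> \<le> B" for k
    using B[OF p[of k]] norm_fst_le[of "fst (p k)" "snd (p k)"]
      norm_snd_le[of "snd (p k)" "fst (p k)"] by simp_all
  then have lim: "(\<lambda>k. fst (p k) / real n ^ k) \<longlonglongrightarrow> 0" "(\<lambda>k. snd (p k) / real m ^ k) \<longlonglongrightarrow> 0"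
    using power_to_0[OF n2, of "\<lambda>k. fst (p k)" B] power_to_0[OF m2, of "\<lambda>k. snd (p k)" B] by auto
  show ?thesis
    unfolding tail_map_def digit_point_def
    using tendsto_Pair[OF tendsto_add[OF summable_LIMSEQ[OF summable_digits(1)[of d, OF d]] lim(1)]
        tendsto_add[OF summable_LIMSEQ[OF summable_digits(2)[of d, OF d]] lim(2)]]
    by (simp only: add_0_right)
qed

private lemma digit_point_split:
  assumes d: "\<And>k. d k \<in> \<Lambda>"
  shows "digit_point n m d = carpet_map n m (d 0) (digit_point n m (\<lambda>k. d (Suc k)))"
proof -
  have "(\<Sum>k. real (fst (d k)) / real n ^ Suc k)
      = ((\<Sum>k. real (fst (d (Suc k))) / real n ^ Suc k) + real (fst (d 0))) / real n"
    using suminf_split_head[OF summable_digits(1)[of d, OF d]]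
      suminf_divide[OF summable_digits(1)[of "\<lambda>k. d (Suc k)"], of "real n"] d
    by (simp add: add_divide_distrib mult.commute)
  moreover have "(\<Sum>k. real (snd (d k)) / real m ^ Suc k)
      = ((\<Sum>k. real (snd (d (Suc k))) / real m ^ Suc k) + real (snd (d 0))) / real m"
    using suminf_split_head[OF summable_digits(2)[of d, OF d]]
      suminf_divide[OF summable_digits(2)[of "\<lambda>k. d (Suc k)"], of "real m"] d
    by (simp add: add_divide_distrib mult.commute)
  ultimately show ?thesis by (simp only: digit_point_def carpet_map_def fst_conv snd_conv)
qed

private abbreviation codes :: "(nat \<Rightarrow> nat \<times> nat) set" where
  "codes \<equiv> {d. \<forall>k. d k \<in> \<Lambda>}"

private lemma codes_invariant:
  "digit_point n m ` codes = (\<Union>f\<in>carpet_map n m ` \<Lambda>. f ` digit_point n m ` codes)"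
proof (intro equalityI subsetI)
  fix x assume "x \<in> digit_point n m ` codes"
  then obtain d where d: "\<And>k. d k \<in> \<Lambda>" "x = digit_point n m d" by blast
  have "x = carpet_map n m (d 0) (digit_point n m (\<lambda>k. d (Suc k)))"
    unfolding d(2) by (rule digit_point_split[of d, OF d(1)])
  then show "x \<in> (\<Union>f\<in>carpet_map n m ` \<Lambda>. f ` digit_point n m ` codes)"
    using d by blast
next
  fix x assume "x \<in> (\<Union>f\<in>carpet_map n m ` \<Lambda>. f ` digit_point n m ` codes)"
  then obtain e d where ed: "e \<in> \<Lambda>" "\<And>k. d k \<in> \<Lambda>" "x = carpet_map n m e (digit_point n m d)"
    by blast
  have c: "case_nat e d k \<in> \<Lambda>" for k using ed by (cases k) auto
  have "x = digit_point n m (case_nat e d)"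
    unfolding ed(3) by (subst digit_point_split[of "case_nat e d", OF c]) simp
  then show "x \<in> digit_point n m ` codes" using c by blast
qed

private lemma codes_compact: "compact codes"
proof -
  have fin: "finite \<Lambda>" using digits finite_subset by blast
  have "compactin (product_topology (\<lambda>_. euclidean) UNIV) (\<Pi>\<^sub>E i\<in>(UNIV::nat set). \<Lambda>)"
    using fin by (auto simp: compactin_PiE compactin_euclidean_iff finite_imp_compact)
  then show ?thesis
    by (simp add: compactin_euclidean_iff euclidean_product_topology PiE_UNIV_domain Pi_def)
qed

private lemma codes_continuous: "continuous_on codes (digit_point n m)"
proof -
  have of_nat: "continuous_on UNIV (real :: nat \<Rightarrow> real)"
    by (auto simp: continuous_on_open_vimage open_discrete)
  have proj: "continuous_on codes (\<lambda>d. d k)" for k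
    by (intro continuous_on_subset[OF continuous_on_product_coordinates]) auto
  have coord: "continuous_on codes (\<lambda>d. real (fst (d k)))"
      "continuous_on codes (\<lambda>d. real (snd (d k)))" for k
    by (intro continuous_on_compose2[OF of_nat] continuous_on_fst continuous_on_snd proj; simp)+
  have u: "continuous_on codes (\<lambda>d. \<Sum>k. g (d k) / b ^ Suc k)"
    if coord: "\<And>k. continuous_on codes (\<lambda>d. g (d k))"
      and "\<And>e k. e \<in> \<Lambda> \<Longrightarrow> g e / b ^ Suc k \<le> (1/2) ^ k" "\<And>e. g e \<ge> 0" "b > 0"
    for g :: "nat \<times> nat \<Rightarrow> real" and b
  proof (rule uniform_limit_theorem)
    show "uniform_limit codes (\<lambda>N d. \<Sum>k<N. g (d k) / b ^ Suc k)
        (\<lambda>d. \<Sum>k. g (d k) / b ^ Suc k) sequentially"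
      using that by (intro Weierstrass_m_test[OF _ half_summable]) (auto simp: abs_mult)
    show "\<forall>\<^sub>F N in sequentially. continuous_on codes (\<lambda>d. \<Sum>k<N. g (d k) / b ^ Suc k)"
      using that by (intro always_eventually allI continuous_intros coord) auto
  qed simp
  show ?thesis
    unfolding digit_point_def
    using n2 m2 fst_le snd_le coord by (intro continuous_on_Pair u) auto
qed

private lemma invariant_eq_codes:
  assumes K: "compact K" "K \<noteq> {}" "K = (\<Union>f\<in>carpet_map n m ` \<Lambda>. f ` K)"
  shows "K = digit_point n m ` codes"
proof (intro equalityI subsetI)
  fix x assume x: "x \<in> K"
  have step: "\<exists>q. q \<in> \<Lambda> \<times> K \<and> y = carpet_map n m (fst q) (snd q)" if "y \<in> K" for y
  proof -
    from that have "y \<in> (\<Union>f\<in>carpet_map n m ` \<Lambda>. f ` K)" using K(3) by simp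
    then show ?thesis by force
  qed
  have "\<exists>s. \<forall>k. s k \<in> \<Lambda> \<times> K
      \<and> snd (s k) = carpet_map n m (fst (s (Suc k))) (snd (s (Suc k)))
      \<and> (k = 0 \<longrightarrow> x = carpet_map n m (fst (s k)) (snd (s k)))"
  proof -
    have "\<exists>s. \<forall>k. (s k \<in> \<Lambda> \<times> K \<and> (k = 0 \<longrightarrow> x = carpet_map n m (fst (s k)) (snd (s k))))
        \<and> snd (s k) = carpet_map n m (fst (s (Suc k))) (snd (s (Suc k)))"
    proof (rule dependent_nat_choice)
      show "\<exists>q. q \<in> \<Lambda> \<times> K \<and> ((0::nat) = 0 \<longrightarrow> x = carpet_map n m (fst q) (snd q))"
        using step[OF x] by simp
    next
      fix q and k :: nat assume "q \<in> \<Lambda> \<times> K \<and> (k = 0 \<longrightarrow> x = carpet_map n m (fst q) (snd q))"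
      then have "snd q \<in> K" by auto
      from step[OF this] show "\<exists>y. (y \<in> \<Lambda> \<times> K \<and> (Suc k = 0 \<longrightarrow> x = carpet_map n m (fst y) (snd y)))
          \<and> snd q = carpet_map n m (fst y) (snd y)" by simp
    qed
    then show ?thesis by blast
  qed
  then obtain s where s: "\<And>k. s k \<in> \<Lambda> \<times> K"
      "\<And>k. snd (s k) = carpet_map n m (fst (s (Suc k))) (snd (s (Suc k)))"
      "x = carpet_map n m (fst (s 0)) (snd (s 0))" by blast
  define d p where "d = (\<lambda>k. fst (s k))" and "p = case_nat x (\<lambda>k. snd (s k))"
  have d: "d k \<in> \<Lambda>" for k using s(1)[of k] by (auto simp: d_def)
  have p: "p k \<in> K" for k using s(1)[of "k - 1"] x by (cases k) (auto simp: p_def)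
  have pS: "p k = carpet_map n m (d k) (p (Suc k))" for k
  proof (cases k)
    case 0 then show ?thesis using s(3) by (simp add: p_def d_def)
  next
    case (Suc j) then show ?thesis using s(2)[of j] by (simp only: p_def d_def nat.case)
  qed
  have "tail_map k d (p k) = x" for k
  proof (induction k)
    case 0 show ?case by (simp add: tail_map_def p_def)
  next
    case (Suc k) then show ?case by (simp only: tail_map_Suc pS[of k, symmetric])
  qed
  then have "x = digit_point n m d"
    using tail_map_tendsto[of d p K, OF d p compact_imp_bounded[OF K(1)]]
    by (simp add: LIMSEQ_const_iff)
  then show "x \<in> digit_point n m ` codes" using d by blast
next
  fix x assume "x \<in> digit_point n m ` codes"
  then obtain d where d: "\<And>k. d k \<in> \<Lambda>" "x = digit_point n m d" by blast
  obtain p where p: "p \<in> K" using K(2) by blast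
  have map_in: "carpet_map n m e q \<in> K" if "e \<in> \<Lambda>" "q \<in> K" for e q
    by (subst K(3)) (rule UN_I[where a = "carpet_map n m e"]; use that in simp)
  have in_K: "tail_map k d q \<in> K" if "q \<in> K" for k q
    using that
  proof (induction k arbitrary: q)
    case 0 then show ?case by (simp add: tail_map_def)
  next
    case (Suc k) then show ?case using map_in[OF d(1)] by (simp only: tail_map_Suc)
  qed
  have "(\<lambda>k. tail_map k d p) \<longlonglongrightarrow> x"
    unfolding d(2)
    by (rule tail_map_tendsto[where K = K]) (use d(1) p compact_imp_bounded[OF K(1)] in auto)
  then show "x \<in> K"
    by (rule closed_sequentially[OF compact_imp_closed[OF K(1)], rotated]) (rule in_K[OF p])
qed

lemma carpet_attractor_unique:
  "\<exists>!K. compact K \<and> K \<noteq> {} \<and> K = (\<Union>f\<in>carpet_map n m ` \<Lambda>. f ` K)"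
proof (rule ex1I)
  show "compact (digit_point n m ` codes) \<and> digit_point n m ` codes \<noteq> {} \<and>
      digit_point n m ` codes = (\<Union>f\<in>carpet_map n m ` \<Lambda>. f ` digit_point n m ` codes)"
    using compact_continuous_image[OF codes_continuous codes_compact] nonempty
    by (intro conjI codes_invariant) auto
qed (elim conjE, rule invariant_eq_codes)

lemma carpet_eq_digits:
  "carpet n m \<Lambda> = {digit_point n m d | d. \<forall>k. d k \<in> \<Lambda>}"
proof -
  have "carpet n m \<Lambda> = digit_point n m ` codes"
    using theI'[OF carpet_attractor_unique] unfolding carpet_def ifs_attractor_def
    by (intro invariant_eq_codes) (elim conjE, assumption)+
  then show ?thesis by blast
qed

end

end

theory Submission
  imports Defs
begin

text \<open>Write \<open>P\<close> for the projection of the carpet \<open>K\<close> to the vertical axis, and \<open>T\<close> for the expansion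
  \<open>(x, y) \<mapsto> (n x, m y)\<close>, which maps the periodic set \<open>K + \<int>\<^sup>2\<close> into itself. Suppose that \<open>f\<close> maps \<open>K\<close>
  into itself and is oblique, so that all four entries of its linear part are nonzero. Since \<open>K\<close> is
  not contained in a line, \<open>\<Lambda>\<close> meets at least two rows and \<open>P\<close> is infinite. The proof shows that \<open>\<Lambda>\<close>
  consists of all \<open>m * n\<close> digits.

  The source of rigidity is that cylinders of \<open>K\<close> of level \<open>l\<close> are tall and thin, since \<open>m < n\<close>: up to a
  small error such a cylinder is a vertical copy of \<open>P\<close> of height \<open>1 / m ^ l\<close>. Its image under \<open>f\<close> is an
  oblique copy, which lies in \<open>K\<close> as well. Choose \<open>k\<close> with \<open>n ^ k\<close> comparable to \<open>m ^ l\<close>. Then \<open>T ^ k\<close>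
  flattens the oblique copy, and in the limit \<open>K + \<int>\<^sup>2\<close> contains a horizontal copy of \<open>P\<close>
  (\<open>Ktilde_contains_horizontal_copy_of_P\<close>). This limit and a variant of it for the vertical coordinate
  alone lead to three conclusions, each building on the previous one.

  \<^item> Some row contains two digits. Otherwise a height determines the point of \<open>K\<close> up to two
    choices, so horizontal slices of \<open>K\<close> are finite, whereas \<open>P\<close> is infinite
    (\<open>not_at_most_one_digit_per_row\<close>).

  \<^item> Every row contains a digit. A row with two digits yields a horizontal Cantor set \<open>E\<close> of
    expansions in base \<open>n\<close>. The vertical coordinate of \<open>f\<close> mixes \<open>E\<close> and \<open>P\<close>, so that after
    magnification \<open>\<gamma> + \<sigma> E + \<tau> P \<subseteq> P\<close> with nonzero \<open>\<sigma>\<close> and \<open>\<tau>\<close>. Iterating this inclusion places sums of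
    arbitrarily many copies of \<open>E\<close> of comparable size in \<open>P\<close>, and such sums contain an interval
    (\<open>interval_subset_if_absorbs_binary_sums\<close>). An interval in \<open>P\<close> leaves no room for an empty row.

  \<^item> Every digit occurs. Now \<open>P\<close> is the unit interval, so \<open>K\<close> contains a horizontal segment, and
    its image under \<open>f\<close> is an oblique segment in \<open>K\<close>. Under \<open>T ^ k\<close> this segment becomes long and almost
    horizontal while it still passes through all heights, so it becomes dense modulo \<open>\<int>\<^sup>2\<close>
    (\<open>all_digits_if_K_contains_oblique_segment\<close>).

  The last conclusion contradicts \<open>card \<Lambda> < m * n\<close>.\<close>

section \<open>Limits of magnified pieces\<close>

text \<open>Magnifying smaller and smaller pieces of a set yields copies of a fixed shape up to a
  translation \<open>c k\<close>, a scale \<open>r k\<close> and a vanishing error. Since these two parameters stay in a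
  compact set, they converge along one subsequence, which serves all points \<open>p\<close> at once, and the
  limiting shape stays in the closed set \<open>Z\<close>.\<close>

lemma convergent_family_limit:
  fixes Z :: "'a::euclidean_space set"
  assumes "closed Z" "compact B" and c: "\<And>k. c k \<in> B" and r: "\<And>k. r k \<in> {lo..hi::real}"
    and ev: "\<And>p. p \<in> S \<Longrightarrow> \<forall>\<^sub>F k in sequentially. c k + r k *\<^sub>R u p + w k p \<in> Z"
    and w: "\<And>p. p \<in> S \<Longrightarrow> (\<lambda>k. w k p) \<longlonglongrightarrow> w' p"
  shows "\<exists>c' r'. r' \<in> {lo..hi} \<and> (\<forall>p\<in>S. c' + r' *\<^sub>R u p + w' p \<in> Z)"
proof -
  have "seq_compact (B \<times> {lo..hi})"
    using assms(2) by (intro compact_imp_seq_compact compact_Times) auto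
  moreover have "\<forall>k. (c k, r k) \<in> B \<times> {lo..hi}" using c r by auto
  ultimately obtain cr s where cr: "cr \<in> B \<times> {lo..hi}" and s: "strict_mono (s::nat\<Rightarrow>nat)"
    and lim: "((\<lambda>k. (c k, r k)) \<circ> s) \<longlonglongrightarrow> cr"
    by (rule seq_compactE)
  have lc: "(\<lambda>k. c (s k)) \<longlonglongrightarrow> fst cr" and lr: "(\<lambda>k. r (s k)) \<longlonglongrightarrow> snd cr"
    using tendsto_fst[OF lim] tendsto_snd[OF lim] by (simp_all add: o_def)
  have "fst cr + snd cr *\<^sub>R u p + w' p \<in> Z" if p: "p \<in> S" for p
  proof -
    have "(\<lambda>k. c (s k) + r (s k) *\<^sub>R u p + w (s k) p) \<longlonglongrightarrow> fst cr + snd cr *\<^sub>R u p + w' p"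
      using LIMSEQ_subseq_LIMSEQ[OF w[OF p] s]
      by (intro tendsto_intros lc lr) (simp add: o_def)
    moreover have "\<forall>\<^sub>F k in sequentially. c (s k) + r (s k) *\<^sub>R u p + w (s k) p \<in> Z"
      using eventually_subseq[OF s ev[OF p]] .
    ultimately show ?thesis
      by (intro Lim_in_closed_set[OF \<open>closed Z\<close> _ sequentially_bot])
  qed
  then show ?thesis using cr by (intro exI[of _ "fst cr"] exI[of _ "snd cr"]) auto
qed

section \<open>Sums of Cantor sets that contain an interval\<close>

text \<open>The inclusions \<open>J \<subseteq> (J + D) / b\<close> and \<open>(S + D) / b \<subseteq> S\<close> compare \<open>J\<close> with the attractor of the
  contractions \<open>\<lambda>s. (s + d) / b\<close>: reading off the first \<open>h\<close> digits of \<open>x \<in> J\<close> and applying the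
  matching contractions to any point of \<open>S\<close> reaches \<open>x\<close> up to an error of order \<open>1 / b ^ h\<close>.\<close>

lemma subset_closure_if_digits_cover:
  fixes b :: real
  assumes b: "1 < b" and S: "S \<noteq> {}" "\<And>s d. s \<in> S \<Longrightarrow> d \<in> D \<Longrightarrow> (s + d) / b \<in> S"
    and J: "bounded J" "\<And>x. x \<in> J \<Longrightarrow> \<exists>d\<in>D. b * x - d \<in> J"
  shows "J \<subseteq> closure S"
proof
  fix x assume x: "x \<in> J"
  obtain s0 where s0: "s0 \<in> S" using S by auto
  obtain C where C: "\<And>x. x \<in> J \<Longrightarrow> \<bar>x\<bar> \<le> C" using J(1) by (auto simp: bounded_iff)
  have approx: "\<exists>s\<in>S. \<bar>x - s\<bar> \<le> (C + \<bar>s0\<bar>) / b ^ h" if "x \<in> J" for x h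
    using that
  proof (induction h arbitrary: x)
    case 0 then show ?case using s0 C[of x] by (intro bexI[of _ s0]) auto
  next
    case (Suc h)
    then obtain d where d: "d \<in> D" "b * x - d \<in> J" using J(2) by blast
    then obtain s where s: "s \<in> S" "\<bar>b * x - d - s\<bar> \<le> (C + \<bar>s0\<bar>) / b ^ h" using Suc by blast
    have "\<bar>x - (s + d) / b\<bar> = \<bar>b * x - d - s\<bar> / b"
      using b by (subst abs_div_pos) (auto simp: field_simps)
    also have "\<dots> \<le> (C + \<bar>s0\<bar>) / b ^ h / b" using s b by (intro divide_right_mono) auto
    finally show ?case using S(2)[OF s(1) d(1)] by (intro bexI[of _ "(s + d) / b"]) (auto simp: mult.commute)
  qed
  have "(\<lambda>h. (C + \<bar>s0\<bar>) / b ^ h) \<longlonglongrightarrow> 0"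
    using b by (rule LIMSEQ_divide_realpow_zero)
  then have *: "\<exists>h. (C + \<bar>s0\<bar>) / b ^ h < e" if "e > 0" for e
    using that by (metis (no_types, lifting) eventually_sequentially order_tendstoD(2) order_refl)
  show "x \<in> closure S"
    unfolding closure_approachable
  proof (intro allI impI)
    fix e :: real assume "e > 0"
    then obtain h where "(C + \<bar>s0\<bar>) / b ^ h < e" using * by blast
    with approx[OF x, of h] show "\<exists>y\<in>S. dist y x < e" by (auto simp: dist_real_def abs_minus_commute intro: le_less_trans)
  qed
qed

text \<open>The finite sums of distinct powers \<open>1 / b ^ t\<close> with \<open>t > 0\<close>. Their closure is a Cantor set when
  \<open>b > 2\<close>. Only the dense subset of finite sums appears below, because each of them is realised by
  finitely many digits.\<close>

inductive_set binary_sums :: "real \<Rightarrow> real set" for b :: real where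
  zero: "0 \<in> binary_sums b"
| shift: "e \<in> binary_sums b \<Longrightarrow> e / b \<in> binary_sums b"
| add_digit: "e \<in> binary_sums b \<Longrightarrow> (e + 1) / b \<in> binary_sums b"

lemma binary_sums_bounds:
  assumes "e \<in> binary_sums b" "2 \<le> b" shows "0 \<le> e" "e \<le> 1"
  using assms by (induction) (auto simp: field_simps)

lemma binary_sums_div_power:
  assumes "e \<in> binary_sums b" shows "e / b ^ h \<in> binary_sums b"
proof (induction h)
  case (Suc h)
  then show ?case using binary_sums.shift[OF Suc] by (simp add: field_simps)
qed (use assms in simp)

lemma real_power_bracket:
  fixes x b :: real
  assumes "1 < b" "1 \<le> x"
  shows "\<exists>h. b ^ h \<le> x \<and> x < b ^ Suc h"
proof -
  obtain N where N: "x < b ^ N" using real_arch_pow[OF assms(1)] by blast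
  define h where "h = (LEAST N. x < b ^ N)"
  have h: "x < b ^ h" unfolding h_def by (rule LeastI[of _ N]) (rule N)
  then have "h \<noteq> 0" using assms by (intro notI) auto
  then obtain g where g: "h = Suc g" by (cases h) auto
  have "\<not> x < b ^ g" using not_less_Least[of g "\<lambda>N. x < b ^ N"] g by (simp add: h_def)
  then show ?thesis using h g by (intro exI[of _ g]) auto
qed

text \<open>The sum \<open>S\<close> of \<open>k\<close> scaled copies of \<open>binary_sums n\<close> is invariant under \<open>\<lambda>s. (s + D q) / n\<close>, where
  \<open>D q = (\<Sum>i<q. r i)\<close>: append the digit 1 in the first \<open>q\<close> summands and 0 in the others. Consecutive
  values of \<open>D\<close> differ by at most \<open>n * \<rho>\<close>, and with \<open>n * (n - 1)\<close> summands this is at most the length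
  of the interval in question, so its \<open>k + 1\<close> contracted images overlap and cover it.\<close>

lemma interval_subset_if_comparable_copies:
  fixes n :: nat and r :: "nat \<Rightarrow> real" and \<rho> :: real
  assumes n: "2 \<le> n" and rho: "0 < \<rho>" and k: "k = n * (n - 1)"
    and r: "\<And>i. i < k \<Longrightarrow> \<rho> \<le> r i" "\<And>i. i < k \<Longrightarrow> r i \<le> n * \<rho>"
  shows "{0..(\<Sum>i<k. r i) / (n - 1)} \<subseteq> closure {\<Sum>i<k. r i * e i |e. \<forall>i. e i \<in> binary_sums n}"
    (is "{0..?R / _} \<subseteq> closure ?S")
proof -
  define D where "D q = (\<Sum>i<q. r i)" for q
  have n1: "real n - 1 > 0" using n by simp
  have R: "real n * \<rho> \<le> ?R / (real n - 1)"
  proof -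
    have "real k * \<rho> = (\<Sum>i<k. \<rho>)" by simp
    also have "\<dots> \<le> ?R" using r by (intro sum_mono) auto
    finally show ?thesis using n1 n by (simp add: k field_simps)
  qed
  have "{0..?R / (real n - 1)} \<subseteq> closure ?S"
  proof (rule subset_closure_if_digits_cover[where b = n and D = "D ` {..k}"])
    show "1 < real n" using n by simp
    show "?S \<noteq> {}" using binary_sums.zero[of n] by auto
    show "bounded {0..?R / (real n - 1)}" by simp
  next
    fix s d assume "s \<in> ?S" "d \<in> D ` {..k}"
    then obtain e q where e: "\<And>i. e i \<in> binary_sums n" "s = (\<Sum>i<k. r i * e i)" and q: "q \<le> k" "d = D q" by auto
    have "D q = (\<Sum>i<k. r i * (if i < q then 1 else 0))"
    proof -
      have "(\<Sum>i<k. r i * (if i < q then 1 else 0)) = (\<Sum>i<k. if i < q then r i else 0)"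
        by (intro sum.cong) auto
      also have "\<dots> = (\<Sum>i\<in>{..<k} \<inter> {i. i < q}. r i)"
        by (simp add: sum.If_cases)
      also have "{..<k} \<inter> {i. i < q} = {..<q}" using q by auto
      finally show ?thesis by (simp add: D_def)
    qed
    then have "(s + d) / n = (\<Sum>i<k. r i * ((e i + (if i < q then 1 else 0)) / n))"
      by (simp add: e q sum.distrib[symmetric] sum_divide_distrib distrib_left)
    moreover have "(e i + (if i < q then 1 else 0)) / n \<in> binary_sums n" for i
      using binary_sums.intros(2,3)[OF e(1)[of i]] by auto
    ultimately show "(s + d) / n \<in> ?S"
      by (intro CollectI exI[of _ "\<lambda>i. (e i + (if i < q then 1 else 0)) / n"]) auto
  next
    fix x assume x: "x \<in> {0..?R / (real n - 1)}"
    define q where "q = (GREATEST q. q \<le> k \<and> D q \<le> n * x)"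
    have "0 \<le> k \<and> D 0 \<le> n * x" using x by (simp add: D_def)
    then have q: "q \<le> k" "D q \<le> n * x"
      unfolding q_def using GreatestI_nat[of "\<lambda>q. q \<le> k \<and> D q \<le> n * x" 0 k] by auto
    have "n * x - D q \<le> ?R / (real n - 1)"
    proof (cases "q = k")
      case True
      have "real n * x \<le> n * (?R / (real n - 1))" using x by (intro mult_left_mono) auto
      also have "\<dots> = ?R / (real n - 1) + D q" using n1 True by (simp add: D_def field_simps)
      finally show ?thesis by simp
    next
      case False
      have "\<not> (Suc q \<le> k \<and> D (Suc q) \<le> n * x)"
        using Greatest_le_nat[of "\<lambda>q. q \<le> k \<and> D q \<le> n * x" "Suc q" k] unfolding q_def[symmetric] by auto
      then have "n * x < D q + r q" using False q by (simp add: D_def)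
      also have "r q \<le> ?R / (real n - 1)" using r(2)[of q] R False q by simp
      finally show ?thesis by simp
    qed
    then show "\<exists>d\<in>D ` {..k}. real n * x - d \<in> {0..?R / (real n - 1)}" using q by auto
  qed
  then show ?thesis using n by (simp add: of_nat_diff)
qed

text \<open>Substituting the inclusion \<open>\<gamma> + \<sigma> E + \<tau> P \<subseteq> P\<close> into itself places the sum of the sets \<open>\<sigma> \<tau>\<^sup>i E\<close>,
  for any number of indices \<open>i\<close>, in a translate of \<open>P\<close>. Dividing by powers of \<open>n\<close>, which passes to
  subsets of \<open>E = binary_sums n\<close>, makes these scales comparable, and enough comparable copies of
  \<open>E\<close> add up to an interval.\<close>

lemma interval_subset_if_absorbs_binary_sums:
  fixes P :: "real set" and n :: nat
  assumes n: "2 \<le> n" and P: "closed P" "P \<noteq> {}" and nz: "\<sigma> \<noteq> 0" "\<tau> \<noteq> 0"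
    and absorb: "\<And>e p. e \<in> binary_sums n \<Longrightarrow> p \<in> P \<Longrightarrow> \<gamma> + \<sigma> * e + \<tau> * p \<in> P"
  shows "\<exists>u v. u < v \<and> {u..v} \<subseteq> P"
proof -
  obtain p0 where p0: "p0 \<in> P" using P by auto
  \<comment> \<open>Using the inclusion twice replaces the factor \<open>\<tau>\<close> by its square, so that all scales below are
    positive; the sign of \<open>\<sigma>\<close> only affects the common factor.\<close>
  define t where "t = \<tau>\<^sup>2"
  have t: "t > 0" using nz by (simp add: t_def)
  define g where "g = \<gamma> + \<tau> * \<gamma>"
  have step: "g + \<sigma> * e + t * p \<in> P" if "e \<in> binary_sums n" "p \<in> P" for e p
    using absorb[OF that(1) absorb[OF binary_sums.zero that(2)]]
    by (simp add: g_def t_def algebra_simps power2_eq_square)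
  have iter: "\<exists>g'. \<forall>e. (\<forall>i. e i \<in> binary_sums n) \<longrightarrow> (\<forall>p\<in>P. g' + \<sigma> * (\<Sum>i<k. t ^ i * e i) + t ^ k * p \<in> P)" for k
  proof (induction k)
    case 0 then show ?case by (intro exI[of _ 0]) auto
  next
    case (Suc k)
    then obtain g' where g': "\<And>e p. (\<And>i. e i \<in> binary_sums n) \<Longrightarrow> p \<in> P \<Longrightarrow> g' + \<sigma> * (\<Sum>i<k. t ^ i * e i) + t ^ k * p \<in> P" by blast
    have "(g' + t ^ k * g) + \<sigma> * (\<Sum>i<Suc k. t ^ i * e i) + t ^ Suc k * p \<in> P"
      if "\<forall>i. e i \<in> binary_sums n" "p \<in> P" for e p
      using g'[of e, OF spec[OF that(1)] step[OF spec[OF that(1), of k] that(2)]] by (simp add: algebra_simps)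
    then show ?case by blast
  qed
  define k where "k = n * (n - 1)"
  obtain g' where g': "\<And>e p. (\<And>i. e i \<in> binary_sums n) \<Longrightarrow> p \<in> P \<Longrightarrow> g' + \<sigma> * (\<Sum>i<k. t ^ i * e i) + t ^ k * p \<in> P"
    using iter[of k] by blast
  define \<rho> where "\<rho> = Min ((\<lambda>i. t ^ i) ` {..<k})"
  have k0: "k > 0" using n by (simp add: k_def)
  have \<rho>: "0 < \<rho>" unfolding \<rho>_def using t k0 by (subst Min_gr_iff) auto
  have "\<exists>h. \<rho> \<le> t ^ i / real n ^ h \<and> t ^ i / real n ^ h \<le> n * \<rho>" if "i < k" for i
  proof -
    have "\<rho> \<le> t ^ i" unfolding \<rho>_def using that by (intro Min_le) auto
    then obtain h where "real n ^ h \<le> t ^ i / \<rho>" "t ^ i / \<rho> < real n ^ Suc h"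
      using real_power_bracket[of "real n" "t ^ i / \<rho>"] n \<rho> by auto
    then show ?thesis using n \<rho> by (intro exI[of _ h]) (auto simp: field_simps)
  qed
  then obtain h where h: "\<And>i. i < k \<Longrightarrow> \<rho> \<le> t ^ i / real n ^ h i" "\<And>i. i < k \<Longrightarrow> t ^ i / real n ^ h i \<le> n * \<rho>"
    by metis
  define r where "r i = t ^ i / real n ^ h i" for i
  define S where "S = {\<Sum>i<k. r i * e i |e. \<forall>i. e i \<in> binary_sums n}"
  define G where "G = g' + t ^ k * p0"
  have "S \<subseteq> (\<lambda>x. G + \<sigma> * x) -` P"
  proof
    fix s assume "s \<in> S"
    then obtain e where e: "\<forall>i. e i \<in> binary_sums n" "s = (\<Sum>i<k. r i * e i)" by (auto simp: S_def)
    have "g' + \<sigma> * (\<Sum>i<k. t ^ i * (e i / real n ^ h i)) + t ^ k * p0 \<in> P"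
      by (rule g'[OF _ p0]) (use e in \<open>auto intro: binary_sums_div_power\<close>)
    then show "s \<in> (\<lambda>x. G + \<sigma> * x) -` P" by (simp add: e r_def G_def algebra_simps)
  qed
  moreover have "closed ((\<lambda>x. G + \<sigma> * x) -` P)"
    by (rule closed_vimage[OF P(1)]) (intro continuous_intros)
  ultimately have cl: "closure S \<subseteq> (\<lambda>x. G + \<sigma> * x) -` P" by (rule closure_minimal)
  define M where "M = (\<Sum>i<k. r i) / (n - 1)"
  have "{0..M} \<subseteq> closure S"
    unfolding M_def S_def
    by (rule interval_subset_if_comparable_copies[OF n \<rho> k_def]) (use h in \<open>auto simp: r_def\<close>)
  then have J: "G + \<sigma> * x \<in> P" if "0 \<le> x" "x \<le> M" for x using cl that by auto
  have "(\<Sum>i<k. r i) > 0" using k0 h \<rho> by (intro sum_pos) (auto simp: r_def intro: less_le_trans)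
  then have M: "M > 0" using n by (simp add: M_def)
  have *: "y \<in> P" if "0 \<le> (y - G) / \<sigma>" "(y - G) / \<sigma> \<le> M" for y
    using J[OF that] nz by simp
  have "{G..G + \<sigma> * M} \<subseteq> P \<and> G < G + \<sigma> * M" if "\<sigma> > 0"
    using that M by (auto intro!: * simp: field_simps)
  moreover have "{G + \<sigma> * M..G} \<subseteq> P \<and> G + \<sigma> * M < G" if "\<sigma> < 0"
    using that M by (auto intro!: * simp: field_simps mult_pos_neg mult_neg_pos)
  ultimately show ?thesis using nz(1) by (meson linorder_cases)
qed

section \<open>The carpet, its vertical projection and their periodic extensions\<close>

lemma unit_interval_if_digit_contractions:
  fixes X :: "real set" and b :: nat
  assumes b: "2 \<le> b" and X: "compact X"
    and inv: "\<And>x. x \<in> X \<Longrightarrow> \<exists>x'\<in>X. \<exists>j<b. x = (x' + real j) / b"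
  shows "X \<subseteq> {0..1}"
proof (cases "X = {}")
  case False
  obtain u where u: "u \<in> X" "\<And>x. x \<in> X \<Longrightarrow> u \<le> x" using compact_attains_inf[OF X False] by auto
  obtain v where v: "v \<in> X" "\<And>x. x \<in> X \<Longrightarrow> x \<le> v" using compact_attains_sup[OF X False] by auto
  have b1: "real b - 1 > 0" using b by simp
  obtain u' j where uj: "u' \<in> X" "u = (u' + real j) / b" using inv[OF u(1)] by auto
  have "u \<le> b * u" using uj u(2)[OF uj(1)] b by (simp add: field_simps)
  then have "0 \<le> (real b - 1) * u" by (simp add: algebra_simps)
  then have "0 \<le> u" using b1 by (simp add: zero_le_mult_iff)
  obtain v' i where vi: "v' \<in> X" "i < b" "v = (v' + real i) / b" using inv[OF v(1)] by auto
  have "b * v \<le> v + (real b - 1)" using vi v(2)[OF vi(1)] b by (simp add: field_simps)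
  then have "(real b - 1) * (v - 1) \<le> 0" by (simp add: algebra_simps)
  then have "v \<le> 1" using b1 by (simp add: mult_le_0_iff)
  show ?thesis using u(2) v(2) \<open>0 \<le> u\<close> \<open>v \<le> 1\<close> by force
qed simp

text \<open>The \<open>N\<close>-fold composition of \<open>\<lambda>x. (x + i) / b\<close> is \<open>\<lambda>x. address b i N + x / b ^ N\<close>.\<close>

fun address :: "nat \<Rightarrow> nat \<Rightarrow> nat \<Rightarrow> real" where
  "address b i 0 = 0"
| "address b i (Suc N) = (address b i N + real i) / real b"

locale bedford_mcmullen =
  fixes n m :: nat and \<Lambda> :: "(nat \<times> nat) set"
  assumes m_less_n: "m < n" and m2: "2 \<le> m"
    and digits: "\<Lambda> \<subseteq> {0..<n} \<times> {0..<m}" and digits_nonempty: "\<Lambda> \<noteq> {}"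
begin

lemma n2: "2 \<le> n" using m_less_n m2 by simp
lemma n_pos [simp]: "0 < n" and m_pos [simp]: "0 < m" using n2 m2 by auto

definition K :: "(real \<times> real) set" where "K = carpet n m \<Lambda>"
definition P :: "real set" where "P = snd ` K"
text \<open>Adding all integer translates makes \<open>K\<close> and \<open>P\<close> invariant under the expansions by \<open>(n, m)\<close> and by
  \<open>m\<close>: these act like a shift on digits once integer parts are ignored. Magnified pieces of \<open>K\<close> thus
  stay in one fixed closed set.\<close>

definition Ktilde :: "(real \<times> real) set" where
  "Ktilde = {(x, y). \<exists>(z::int) (w::int). (x - z, y - w) \<in> K}"
definition Ptilde :: "real set" where
  "Ptilde = {y. \<exists>z :: int. y - z \<in> P}"

lemma K_attractor: "compact K \<and> K \<noteq> {} \<and> K = (\<Union>f\<in>carpet_map n m ` \<Lambda>. f ` K)"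
  unfolding K_def carpet_def ifs_attractor_def
  using theI'[OF carpet_attractor_unique[OF n2 m2 digits digits_nonempty]] .

lemma K_compact: "compact K" and K_nonempty: "K \<noteq> {}" using K_attractor by auto

lemma K_map:
  assumes "(i, j) \<in> \<Lambda>" "(x, y) \<in> K" shows "((x + real i) / n, (y + real j) / m) \<in> K"
proof -
  have "carpet_map n m (i, j) (x, y) \<in> (\<Union>f\<in>carpet_map n m ` \<Lambda>. f ` K)" using assms by blast
  then have "carpet_map n m (i, j) (x, y) \<in> K" using K_attractor by metis
  then show ?thesis by (simp add: carpet_map_def)
qed

lemma K_unmap:
  assumes "(x, y) \<in> K"
  obtains i j x' y' where "(i, j) \<in> \<Lambda>" "(x', y') \<in> K" "x = (x' + real i) / n" "y = (y' + real j) / m"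
proof -
  have "(x, y) \<in> (\<Union>f\<in>carpet_map n m ` \<Lambda>. f ` K)" using assms K_attractor by metis
  then show ?thesis using that by (force simp: carpet_map_def)
qed

lemma digit_less: "(i, j) \<in> \<Lambda> \<Longrightarrow> i < n" "(i, j) \<in> \<Lambda> \<Longrightarrow> j < m" using digits by auto

lemma P_compact: "compact P"
  unfolding P_def by (intro compact_continuous_image K_compact continuous_intros)
lemma P_closed: "closed P" using P_compact by (rule compact_imp_closed)
lemma P_nonempty: "P \<noteq> {}" using K_nonempty by (simp add: P_def)
lemma mem_P: "y \<in> P \<longleftrightarrow> (\<exists>x. (x, y) \<in> K)" by (force simp: P_def)

lemma P_map: "(i, j) \<in> \<Lambda> \<Longrightarrow> y \<in> P \<Longrightarrow> (y + real j) / m \<in> P"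
  using K_map unfolding mem_P by blast

lemma P_unmap:
  assumes "y \<in> P" obtains i j y' where "(i, j) \<in> \<Lambda>" "y' \<in> P" "y = (y' + real j) / m"
  using assms K_unmap unfolding mem_P by (metis)

lemma K_unit: assumes "(x, y) \<in> K" shows "x \<in> {0..1}" "y \<in> {0..1}"
proof -
  have "fst ` K \<subseteq> {0..1}"
  proof (rule unit_interval_if_digit_contractions[OF n2])
    show "compact (fst ` K)" by (intro compact_continuous_image K_compact continuous_intros)
    show "\<exists>x'\<in>fst ` K. \<exists>j<n. x = (x' + real j) / n" if x: "x \<in> fst ` K" for x
    proof -
      obtain y where "(x, y) \<in> K" using x by auto
      then obtain i j x' y' where "(i, j) \<in> \<Lambda>" "(x', y') \<in> K" "x = (x' + real i) / n"
        by (rule K_unmap)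
      then show ?thesis using digit_less(1)[of i j] by (intro bexI[of _ x'] exI[of _ i]) force+
    qed
  qed
  then show "x \<in> {0..1}" using assms by force
  have "P \<subseteq> {0..1}"
  proof (rule unit_interval_if_digit_contractions[OF m2 P_compact])
    show "\<exists>x'\<in>P. \<exists>j<m. x = (x' + real j) / m" if "x \<in> P" for x
      using that by (metis P_unmap digit_less(2))
  qed
  then show "y \<in> {0..1}" using assms mem_P by blast
qed

lemma P_unit: "y \<in> P \<Longrightarrow> y \<in> {0..1}" using K_unit mem_P by blast

lemma KtildeI:
  fixes x y :: real and z w :: int
  shows "(x - z, y - w) \<in> K \<Longrightarrow> (x, y) \<in> Ktilde"
  unfolding Ktilde_def by blast

lemma PtildeI:
  fixes y :: real and z :: int
  shows "y - z \<in> P \<Longrightarrow> y \<in> Ptilde"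
  unfolding Ptilde_def by blast

lemma KtildeE:
  fixes x y :: real
  assumes "(x, y) \<in> Ktilde"
  obtains z w :: int where "(x - z, y - w) \<in> K"
  using assms unfolding Ktilde_def by blast

lemma K_subset_Ktilde: "(x, y) \<in> K \<Longrightarrow> (x, y) \<in> Ktilde"
  by (rule KtildeI[of _ 0 _ 0]) simp

lemma P_subset_Ptilde: "y \<in> P \<Longrightarrow> y \<in> Ptilde"
  unfolding Ptilde_def by (auto intro!: exI[of _ "0::int"])

lemma Ktilde_closed: "closed Ktilde"
proof -
  have "closed (\<Union>p\<in>K. \<Union>q\<in>\<int> \<times> \<int>. {p + q})"
    by (intro compact_closed_sums K_compact closed_Times closed_subset_Ints order_refl)
  also have "(\<Union>p\<in>K. \<Union>q\<in>\<int> \<times> \<int>. {p + q}) = Ktilde"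
  proof (intro equalityI subsetI)
    fix q assume "q \<in> Ktilde"
    then obtain z w :: int where "(fst q - z, snd q - w) \<in> K" by (metis KtildeE prod.collapse)
    then show "q \<in> (\<Union>p\<in>K. \<Union>q\<in>\<int> \<times> \<int>. {p + q})"
      by (intro UN_I[of "(fst q - z, snd q - w)"] UN_I[of "(of_int z, of_int w)"]) (auto simp: prod_eq_iff)
  next
    fix q assume "q \<in> (\<Union>p\<in>K. \<Union>q\<in>\<int> \<times> \<int>. {p + q})"
    then obtain x y z w where "(x, y) \<in> K" "q = (x + of_int z, y + of_int w)"
      by (auto elim!: Ints_cases)
    then show "q \<in> Ktilde" using KtildeI[of "x + of_int z" z "y + of_int w" w] by simp
  qed
  finally show ?thesis .
qed

lemma Ptilde_closed: "closed Ptilde"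
proof -
  have "closed (\<Union>p\<in>P. \<Union>q\<in>\<int>. {p + q})"
    by (intro compact_closed_sums P_compact closed_subset_Ints order_refl)
  also have "(\<Union>p\<in>P. \<Union>q\<in>\<int>. {p + q}) = Ptilde"
  proof (intro equalityI subsetI)
    fix y assume "y \<in> Ptilde"
    then obtain z :: int where "y - z \<in> P" by (auto simp: Ptilde_def)
    then show "y \<in> (\<Union>p\<in>P. \<Union>q\<in>\<int>. {p + q})"
      by (intro UN_I[of "y - z"] UN_I[of "of_int z"]) auto
  next
    fix y assume "y \<in> (\<Union>p\<in>P. \<Union>q\<in>\<int>. {p + q})"
    then obtain p z where "p \<in> P" "y = p + of_int z" by (auto elim!: Ints_cases)
    then show "y \<in> Ptilde" using PtildeI[of "p + of_int z" z] by simp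
  qed
  finally show ?thesis .
qed

lemma Ktilde_translate:
  fixes z w :: int
  assumes "(x, y) \<in> Ktilde" shows "(x - z, y - w) \<in> Ktilde"
proof -
  obtain z' w' :: int where "(x - z', y - w') \<in> K" using assms by (rule KtildeE)
  then show ?thesis by (intro KtildeI[of _ "z' - z" _ "w' - w"]) simp
qed

lemma Ptilde_translate:
  fixes z :: int
  assumes "y \<in> Ptilde" shows "y - z \<in> Ptilde"
proof -
  obtain z' :: int where "y - z' \<in> P" using assms by (auto simp: Ptilde_def)
  then show ?thesis unfolding Ptilde_def by (auto intro!: exI[of _ "z' - z"])
qed

lemma Ktilde_expand: "(x::real, y) \<in> Ktilde \<Longrightarrow> (real n ^ k * x, real m ^ k * y) \<in> Ktilde"
proof (induction k)
  case (Suc k)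
  then have "(real n ^ k * x, real m ^ k * y) \<in> Ktilde" by simp
  then obtain z w :: int where "(real n ^ k * x - z, real m ^ k * y - w) \<in> K" by (rule KtildeE)
  then obtain i j x' y' where *: "(x', y') \<in> K" "real n ^ k * x - z = (x' + real i) / n" "real m ^ k * y - w = (y' + real j) / m"
    by (rule K_unmap)
  then have "n ^ Suc k * x - (n * z + i) = x'" "m ^ Suc k * y - (m * w + j) = y'" by (simp_all add: field_simps)
  then show ?case using *(1)
    by (intro KtildeI[of _ "n * z + i" _ "m * w + j"]) simp
qed simp

lemma Ptilde_expand: "y \<in> Ptilde \<Longrightarrow> real m ^ k * y \<in> Ptilde"
proof (induction k)
  case (Suc k)
  then obtain w :: int where "m ^ k * y - w \<in> P" by (auto simp: Ptilde_def)
  then obtain i j y' where *: "y' \<in> P" "m ^ k * y - w = (y' + real j) / m"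
    by (rule P_unmap)
  then have "m ^ Suc k * y - (m * w + j) = y'" by (simp_all add: field_simps)
  then show ?case unfolding Ptilde_def using *(1) by (auto intro!: exI[of _ "m * w + j"])
qed simp

lemma int_digit_unique:
  fixes b i i' :: nat and z z' :: int
  assumes "b * z + i = b * z' + i'" "i < b" "i' < b" shows "i = i'"
  by (metis assms mod_mult_self4 nat_int zmod_int mod_less add.commute)

text \<open>The leading digit of a point that is not on the grid of level one is determined by the cell
  that contains it; hence the cell of a digit outside \<open>\<Lambda>\<close> has no such points.\<close>

lemma Ptilde_digit:
  fixes y :: real and w :: int
  assumes "y \<in> Ptilde" "m * w + j < m * y" "m * y < m * w + j + 1" "j < m"
  shows "j \<in> snd ` \<Lambda>"
proof -
  obtain z :: int where "y - z \<in> P" using assms(1) by (auto simp: Ptilde_def)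
  then obtain i j' y' where *: "(i, j') \<in> \<Lambda>" "y' \<in> P" "y - z = (y' + real j') / m" by (rule P_unmap)
  have "m * y = m * z + j' + y'" using *(3) by (simp add: field_simps)
  then have "real_of_int (m * z + j') < real_of_int (m * w + j + 1)" "real_of_int (m * w + j) < real_of_int (m * z + j' + 1)"
    using P_unit[OF *(2)] assms(2,3) by auto
  then have "m * z + j' = m * w + j" by linarith
  then have "j' = j" using int_digit_unique[of m z j' w j] digit_less(2)[OF *(1)] assms(4) by simp
  then show ?thesis using *(1) by force
qed

lemma Ktilde_digit:
  fixes x y :: real and v w :: int
  assumes "(x, y) \<in> Ktilde" "n * v + i < n * x" "n * x < n * v + i + 1" "i < n"
     "m * w + j < m * y" "m * y < m * w + j + 1" "j < m"
  shows "(i, j) \<in> \<Lambda>"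
proof -
  obtain z u :: int where "(x - z, y - u) \<in> K" using assms(1) by (rule KtildeE)
  then obtain i' j' x' y' where *: "(i', j') \<in> \<Lambda>" "(x', y') \<in> K" "x - z = (x' + real i') / n"  "y - u = (y' + real j') / m" by (rule K_unmap)
  have "n * x = n * z + i' + x'" "m * y = m * u + j' + y'" using *(3,4) by (simp_all add: field_simps)
  then have "real_of_int (m * u + j') < real_of_int (m * w + j + 1)" "real_of_int (m * w + j) < real_of_int (m * u + j' + 1)"
    "real_of_int (n * z + i') < real_of_int (n * v + i + 1)" "real_of_int (n * v + i) < real_of_int (n * z + i' + 1)"
    using K_unit[OF *(2)] assms by auto
  then have "m * u + j' = m * w + j" "n * z + i' = n * v + i" by linarith+
  then have "j' = j" "i' = i"
    using int_digit_unique[of m u j' w j] int_digit_unique[of n z i' v i] digit_less[OF *(1)] assms(4,7) by simp_all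
  then show ?thesis using *(1) by simp
qed

lemma K_address:
  assumes "(i, j) \<in> \<Lambda>" "(x, y) \<in> K"
  shows "(address n i N + x / real n ^ N, address m j N + y / real m ^ N) \<in> K"
proof (induction N)
  case (Suc N)
  from K_map[OF assms(1) this] show ?case by (simp add: add_divide_distrib mult.commute add_ac)
qed (use assms in simp)

text \<open>A word over two digits \<open>(i, j)\<close> and \<open>(i + \<delta>, j)\<close> of the same row has the same effect on the second
  coordinate as the constant word; in the first coordinate each choice of the second digit adds
  \<open>\<delta> / n ^ t\<close>. So one row with two digits places a copy of \<open>binary_sums n\<close> in \<open>K\<close>, at constant height
  up to the error \<open>1 / m ^ N\<close>.\<close>

lemma K_address_binary_sums:
  assumes a: "(i, j) \<in> \<Lambda>" "(i + \<delta>, j) \<in> \<Lambda>" and e: "e \<in> binary_sums n"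
  shows "\<exists>h. \<forall>N\<ge>h. \<forall>x y. (x, y) \<in> K \<longrightarrow>
     (address n i N + \<delta> * e + x / real n ^ N, address m j N + y / real m ^ N) \<in> K"
  using e
proof induction
  case zero
  then show ?case using K_address[OF a(1)] by simp
next
  case (shift e)
  then obtain h where h: "\<And>N x y. h \<le> N \<Longrightarrow> (x, y) \<in> K \<Longrightarrow> (address n i N + \<delta> * e + x / real n ^ N, address m j N + y / real m ^ N) \<in> K" by blast
  have "(address n i N + \<delta> * (e / n) + x / real n ^ N, address m j N + y / real m ^ N) \<in> K"
    if N: "Suc h \<le> N" and xy: "(x, y) \<in> K" for N x y
  proof -
    obtain M where M: "N = Suc M" "h \<le> M" using N by (cases N) auto
    from K_map[OF a(1) h[OF M(2) xy]] show ?thesis by (simp add: M add_divide_distrib mult.commute add_ac)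
  qed
  then show ?case by blast
next
  case (add_digit e)
  then obtain h where h: "\<And>N x y. h \<le> N \<Longrightarrow> (x, y) \<in> K \<Longrightarrow> (address n i N + \<delta> * e + x / real n ^ N, address m j N + y / real m ^ N) \<in> K" by blast
  have "(address n i N + \<delta> * ((e + 1) / n) + x / real n ^ N, address m j N + y / real m ^ N) \<in> K"
    if N: "Suc h \<le> N" and xy: "(x, y) \<in> K" for N x y
  proof -
    obtain M where M: "N = Suc M" "h \<le> M" using N by (cases N) auto
    from K_map[OF a(2) h[OF M(2) xy]] show ?thesis by (simp add: M add_divide_distrib distrib_left mult.commute add_ac)
  qed
  then show ?case by blast
qed

text \<open>Prefixing \<open>k\<close> times the digit \<open>(i, j)\<close> shrinks the copy of \<open>binary_sums n\<close> to size \<open>1 / n ^ k\<close>.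
  For suitable \<open>l\<close> this is comparable to the height \<open>1 / m ^ l\<close> of the cylinder.\<close>

lemma K_address_delayed_binary_sums:
  assumes a: "(i, j) \<in> \<Lambda>" "(i + \<delta>, j) \<in> \<Lambda>" and e: "e \<in> binary_sums n"
  shows "\<exists>h. \<forall>k. \<forall>l\<ge>k+h. \<forall>x y. (x, y) \<in> K \<longrightarrow>
     (address n i l + \<delta> * e / real n ^ k + x / real n ^ l, address m j l + y / real m ^ l) \<in> K"
proof -
  obtain h where h: "\<And>N x y. h \<le> N \<Longrightarrow> (x, y) \<in> K \<Longrightarrow> (address n i N + \<delta> * e + x / real n ^ N, address m j N + y / real m ^ N) \<in> K"
    using K_address_binary_sums[OF assms] by blast
  have "(address n i (k + N) + \<delta> * e / real n ^ k + x / real n ^ (k + N), address m j (k + N) + y / real m ^ (k + N)) \<in> K"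
    if "h \<le> N" "(x, y) \<in> K" for k N x y
  proof (induction k)
    case (Suc k)
    from K_map[OF a(1) this] show ?case by (simp add: add_divide_distrib mult.commute add_ac)
  qed (use h that in simp)
  note * = this
  have "(address n i l + \<delta> * e / real n ^ k + x / real n ^ l, address m j l + y / real m ^ l) \<in> K"
    if "k + h \<le> l" "(x, y) \<in> K" for k l x y
    using that(1) *[of "l - k" x y k, OF _ that(2)] by simp
  then show ?thesis by blast
qed

section \<open>Approximate squares\<close>

text \<open>A cylinder of level \<open>level k\<close> has height comparable to \<open>1 / n ^ k\<close> but is much narrower, because
  \<open>m < n\<close>. This is the choice of scales for which both limits taken below exist.\<close>

definition level :: "nat \<Rightarrow> nat" where
  "level k = (SOME l. real m ^ l \<le> real n ^ k \<and> real n ^ k < real m ^ Suc l)"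

lemma level: "real m ^ level k \<le> real n ^ k" "real n ^ k < real m ^ Suc (level k)"
proof -
  have "\<exists>l. real m ^ l \<le> real n ^ k \<and> real n ^ k < real m ^ Suc l"
    using m2 n2 by (intro real_power_bracket one_le_power) auto
  from someI_ex[OF this] show "real m ^ level k \<le> real n ^ k" "real n ^ k < real m ^ Suc (level k)"
    unfolding level_def by blast+
qed

lemma le_level: "k \<le> level k"
proof -
  have "real m ^ k \<le> real n ^ k" using m_less_n by (intro power_mono) auto
  also have "\<dots> < real m ^ Suc (level k)" by (rule level)
  finally have "k < Suc (level k)" using m2 by (subst (asm) power_strict_increasing_iff) auto
  then show ?thesis by simp
qed

lemma ratio_tendsto: "(\<lambda>k. (real m / real n) ^ k) \<longlonglongrightarrow> 0"
  using m_less_n by (intro LIMSEQ_power_zero) auto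

lemma m_scale_tendsto: "(\<lambda>k. real m ^ k / real m ^ level k) \<longlonglongrightarrow> 0"
proof (rule Lim_null_comparison)
  have "real m ^ k / real m ^ level k \<le> m * (real m / real n) ^ k" for k
    using level(2)[of k] by (simp add: field_simps power_divide)
  then show "\<forall>\<^sub>F k in sequentially. norm (real m ^ k / real m ^ level k) \<le> m * (real m / real n) ^ k"
    by simp
  show "(\<lambda>k. m * (real m / real n) ^ k) \<longlonglongrightarrow> 0"
    using tendsto_mult_left[OF ratio_tendsto, of "real m"] by simp
qed

lemma n_scale_le: "real n ^ k / real n ^ level k \<le> real m ^ k / real m ^ level k"
proof -
  obtain t where t: "level k = k + t" using le_level le_Suc_ex by blast
  have "real m ^ t \<le> real n ^ t" using m_less_n by (intro power_mono) auto
  then show ?thesis unfolding t by (simp add: power_add field_simps)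
qed

lemma n_scale_tendsto: "(\<lambda>k. real n ^ k / real n ^ level k) \<longlonglongrightarrow> 0"
  by (rule Lim_null_comparison[OF _ m_scale_tendsto]) (simp add: n_scale_le)

lemma mn_scale_tendsto: "(\<lambda>k. real m ^ k / real n ^ level k) \<longlonglongrightarrow> 0"
proof (rule Lim_null_comparison[OF _ n_scale_tendsto])
  have "real m ^ k \<le> real n ^ k" for k using m_less_n by (intro power_mono) auto
  then show "\<forall>\<^sub>F k in sequentially. norm (real m ^ k / real n ^ level k) \<le> real n ^ k / real n ^ level k"
    by (simp add: divide_right_mono)
qed

lemma level_ratio_tendsto: "(\<lambda>k. real m ^ level k / real n ^ level k) \<longlonglongrightarrow> 0"
proof (rule Lim_null_comparison[OF _ ratio_tendsto])
  have "(real m / real n) ^ level k \<le> (real m / real n) ^ k" for k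
    using m_less_n by (intro power_decreasing le_level) auto
  then show "\<forall>\<^sub>F k in sequentially. norm (real m ^ level k / real n ^ level k) \<le> (real m / real n) ^ k"
    by (simp add: power_divide)
qed

lemma eventually_add_le_level: "\<forall>\<^sub>F k in sequentially. k + h \<le> level k"
proof -
  have "\<forall>\<^sub>F k in sequentially. real m ^ k / real m ^ level k < 1 / real m ^ h"
    by (rule order_tendstoD(2)[OF m_scale_tendsto]) simp
  then show ?thesis
  proof eventually_elim
    case (elim k)
    then have "real m ^ (k + h) < real m ^ level k" by (simp add: field_simps power_add)
    then have "k + h < level k" using m2 by (subst (asm) power_strict_increasing_iff) auto
    then show ?case by simp
  qed
qed

section \<open>The projection as a Cantor set\<close>

lemma P_cylinder:
  assumes "y \<in> P"
  shows "\<exists>v. (\<forall>x\<in>P. v + x / real m ^ h \<in> P) \<and> (\<exists>y'\<in>P. y = v + y' / real m ^ h)"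
  using assms
proof (induction h arbitrary: y)
  case 0 then show ?case by (intro exI[of _ 0]) auto
next
  case (Suc h)
  obtain i j y1 where y1: "(i, j) \<in> \<Lambda>" "y1 \<in> P" "y = (y1 + real j) / m" using Suc.prems by (rule P_unmap)
  obtain v y' where v: "\<And>x. x \<in> P \<Longrightarrow> v + x / real m ^ h \<in> P" "y' \<in> P" "y1 = v + y' / real m ^ h" using Suc.IH[OF y1(2)] by blast
  have "(v + real j) / m + x / real m ^ Suc h \<in> P" if "x \<in> P" for x
    using P_map[OF y1(1) v(1)[OF that]] by (simp add: add_divide_distrib mult.commute add_ac)
  moreover have "y = (v + real j) / m + y' / real m ^ Suc h"
    using y1 v by (simp add: add_divide_distrib mult.commute add_ac)
  ultimately show ?case using v(2) by blast
qed

text \<open>With a single row \<open>j\<close>, both the least and the greatest element of \<open>P\<close> are compared with their images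
  under one contraction, which forces them to coincide.\<close>

lemma K_in_line_if_one_row:
  assumes one: "\<And>i j i' j'. (i, j) \<in> \<Lambda> \<Longrightarrow> (i', j') \<in> \<Lambda> \<Longrightarrow> j = j'"
  shows "\<exists>L. is_line L \<and> K \<subseteq> L"
proof -
  obtain i j where ij: "(i, j) \<in> \<Lambda>" using digits_nonempty by auto
  have step: "\<exists>y'\<in>P. y = (y' + real j) / m" if "y \<in> P" for y
    using that ij one by (metis P_unmap)
  obtain u where u: "u \<in> P" "\<And>y. y \<in> P \<Longrightarrow> u \<le> y" using compact_attains_inf[OF P_compact P_nonempty] by auto
  obtain v where v: "v \<in> P" "\<And>y. y \<in> P \<Longrightarrow> y \<le> v" using compact_attains_sup[OF P_compact P_nonempty] by auto
  obtain u' where u': "u' \<in> P" "u = (u' + real j) / m" using step[OF u(1)] by blast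
  obtain v' where v': "v' \<in> P" "v = (v' + real j) / m" using step[OF v(1)] by blast
  have "m * u \<ge> u + j" "m * v \<le> v + j" using u' v' u(2)[OF u'(1)] v(2)[OF v'(1)] by (simp_all add: field_simps)
  then have "(real m - 1) * (v - u) \<le> 0" by (simp add: algebra_simps)
  then have "v \<le> u" using m2 by (simp add: mult_le_0_iff)
  then have const: "y = u" if "y \<in> P" for y using u(2)[OF that] v(2)[OF that] by simp
  define L :: "(real \<times> real) set" where "L = {z. (0, 1) \<bullet> z = u}"
  have "is_line L"
    unfolding is_line_def L_def using aff_dim_hyperplane[of "(0::real, 1::real)" u] affine_hyperplane
    by (auto simp: zero_prod_def)
  moreover have "K \<subseteq> L" using const unfolding L_def P_def by (auto simp: inner_prod_def)
  ultimately show ?thesis by blast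
qed

lemma P_close_pair:
  assumes "(i, j) \<in> \<Lambda>" "(i', j') \<in> \<Lambda>" "j \<noteq> j'"
  shows "\<exists>d>0. \<forall>N. \<exists>y\<in>P. \<exists>y'\<in>P. y - y' = d / real m ^ N"
proof -
  obtain p where p: "p \<in> P" using P_nonempty by auto
  define y y' where "y = (p + real j) / m" and "y' = (p + real j') / m"
  have yy: "y \<in> P" "y' \<in> P" "y \<noteq> y'" using P_map[OF assms(1) p] P_map[OF assms(2) p] assms(3) by (auto simp: y_def y'_def)
  have *: "address m j N + x / real m ^ N \<in> P" if "x \<in> P" for x N
  proof -
    obtain x' where "(x', x) \<in> K" using \<open>x \<in> P\<close> mem_P by auto
    from K_address[OF assms(1) this] show ?thesis unfolding mem_P by blast
  qed
  have "\<exists>a\<in>P. \<exists>b\<in>P. a - b = \<bar>y - y'\<bar> / real m ^ N" for N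
  proof (cases "y < y'")
    case True
    then have "(address m j N + y' / real m ^ N) - (address m j N + y / real m ^ N) = \<bar>y - y'\<bar> / real m ^ N"
      by (simp add: diff_divide_distrib)
    then show ?thesis using *[OF yy(1), of N] *[OF yy(2), of N] by metis
  next
    case False
    then have "(address m j N + y / real m ^ N) - (address m j N + y' / real m ^ N) = \<bar>y - y'\<bar> / real m ^ N"
      by (simp add: diff_divide_distrib)
    then show ?thesis using *[OF yy(1), of N] *[OF yy(2), of N] by metis
  qed
  then show ?thesis using yy(3) by (intro exI[of _ "\<bar>y - y'\<bar>"]) auto
qed

lemma P_infinite:
  assumes "(i, j) \<in> \<Lambda>" "(i', j') \<in> \<Lambda>" "j \<noteq> j'"
  shows "infinite P"
proof
  assume "finite P"
  obtain d where d: "d > 0" "\<And>N. \<exists>y\<in>P. \<exists>y'\<in>P. y - y' = d / real m ^ N" using P_close_pair[OF assms] by blast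
  have "range (\<lambda>N. d / real m ^ N) \<subseteq> (\<lambda>(a, b). a - b) ` (P \<times> P)"
  proof
    fix x assume "x \<in> range (\<lambda>N. d / real m ^ N)"
    then obtain N where "x = d / real m ^ N" by auto
    then obtain y y' where "y \<in> P" "y' \<in> P" "x = y - y'" using d(2)[of N] by metis
    then show "x \<in> (\<lambda>(a, b). a - b) ` (P \<times> P)" by (intro image_eqI[of _ _ "(y, y')"]) auto
  qed
  then have "finite (range (\<lambda>N. d / real m ^ N))" using \<open>finite P\<close> by (meson finite_SigmaI finite_imageI finite_subset)
  moreover have "inj (\<lambda>N. d / real m ^ N)"
  proof (rule injI)
    fix M N assume "d / real m ^ M = d / real m ^ N"
    then have "real m ^ M = real m ^ N" using d(1) by (simp add: frac_eq_eq)
    then show "M = N" using m2 by (subst (asm) power_inject_exp) auto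
  qed
  ultimately show False using range_inj_infinite by blast
qed

lemma eventually_divide_power_less:
  fixes b :: nat and C \<epsilon> :: real
  assumes "2 \<le> b" "0 < \<epsilon>" shows "\<forall>\<^sub>F h in sequentially. C / real b ^ h < \<epsilon>"
proof -
  have "(\<lambda>h. C / real b ^ h) \<longlonglongrightarrow> 0" using assms by (intro LIMSEQ_divide_realpow_zero) auto
  then show ?thesis using assms(2) by (rule order_tendstoD(2))
qed

text \<open>An inclusion into \<open>Ptilde\<close> may hit several integer translates of \<open>P\<close>. As \<open>P\<close> contains pairs of
  points at arbitrarily small distance, some value \<open>\<gamma> + \<tau> * y0\<close> is not an integer; then the image of a
  small cylinder around \<open>y0\<close> lies strictly between two consecutive integers and hence in a single
  translate. Cylinders of \<open>P\<close> are copies of \<open>P\<close>, so the inclusion keeps its shape.\<close>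

lemma P_absorbs_if_Ptilde_absorbs:
  assumes rows: "(i, j) \<in> \<Lambda>" "(i', j') \<in> \<Lambda>" "j \<noteq> j'" and nz: "\<sigma> \<noteq> 0" "\<tau> \<noteq> 0"
    and absorb: "\<And>e y. e \<in> binary_sums n \<Longrightarrow> y \<in> P \<Longrightarrow> \<gamma> + \<sigma> * e + \<tau> * y \<in> Ptilde"
  shows "\<exists>\<gamma>' \<sigma>' \<tau>'. \<sigma>' \<noteq> 0 \<and> \<tau>' \<noteq> 0 \<and> (\<forall>e\<in>binary_sums n. \<forall>y\<in>P. \<gamma>' + \<sigma>' * e + \<tau>' * y \<in> P)"
proof -
  obtain y0 where y0: "y0 \<in> P" "\<gamma> + \<tau> * y0 \<notin> \<int>"
  proof (rule ccontr)
    assume "\<not> thesis"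
    then have int: "\<And>y. y \<in> P \<Longrightarrow> \<gamma> + \<tau> * y \<in> \<int>" using that by blast
    obtain d where d: "d > 0" "\<And>N. \<exists>y\<in>P. \<exists>y'\<in>P. y - y' = d / real m ^ N" using P_close_pair[OF rows] by blast
    obtain N where N: "\<bar>\<tau>\<bar> * d / real m ^ N < 1"
      using eventually_happens'[OF sequentially_bot eventually_divide_power_less[OF m2 zero_less_one]] by blast
    obtain y y' where y: "y \<in> P" "y' \<in> P" "y - y' = d / real m ^ N" using d(2) by blast
    have "(\<gamma> + \<tau> * y) - (\<gamma> + \<tau> * y') \<in> \<int>" using int y by (intro Ints_diff)
    also have "(\<gamma> + \<tau> * y) - (\<gamma> + \<tau> * y') = \<tau> * (d / real m ^ N)" unfolding y(3)[symmetric] by (simp add: algebra_simps)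
    finally have "\<tau> * (d / real m ^ N) \<in> \<int>" .
    moreover have "\<tau> * (d / real m ^ N) \<noteq> 0" using d nz by simp
    moreover have "\<bar>\<tau> * (d / real m ^ N)\<bar> < 1" using N d by (simp add: abs_mult)
    ultimately show False using Ints_nonzero_abs_less1 by blast
  qed
  define z where "z = \<lfloor>\<gamma> + \<tau> * y0\<rfloor>"
  define \<epsilon> where "\<epsilon> = min (\<gamma> + \<tau> * y0 - z) (z + 1 - (\<gamma> + \<tau> * y0))"
  have "\<gamma> + \<tau> * y0 \<noteq> z" using y0 by auto
  then have \<epsilon>: "\<epsilon> > 0" unfolding \<epsilon>_def z_def by linarith
  have "\<forall>\<^sub>F h in sequentially. \<bar>\<sigma>\<bar> / real n ^ h < \<epsilon> / 2 \<and> \<bar>\<tau>\<bar> / real m ^ h < \<epsilon> / 2"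
    using \<epsilon> by (intro eventually_conj eventually_divide_power_less n2 m2) auto
  then obtain h where h: "\<bar>\<sigma>\<bar> / real n ^ h < \<epsilon> / 2" "\<bar>\<tau>\<bar> / real m ^ h < \<epsilon> / 2"
    using eventually_happens'[OF sequentially_bot] by blast
  obtain v y' where v: "\<And>x. x \<in> P \<Longrightarrow> v + x / real m ^ h \<in> P" "y' \<in> P" "y0 = v + y' / real m ^ h" using P_cylinder[OF y0(1)] by blast
  have "(\<gamma> + \<tau> * v - z) + (\<sigma> / real n ^ h) * e + (\<tau> / real m ^ h) * y \<in> P" if e: "e \<in> binary_sums n" and y: "y \<in> P" for e y
  proof -
    define Y where "Y = \<gamma> + \<sigma> * (e / real n ^ h) + \<tau> * (v + y / real m ^ h)"
    have "Y \<in> Ptilde" unfolding Y_def using absorb[OF binary_sums_div_power[OF e] v(1)[OF y]] .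
    then obtain w :: int where w: "Y - w \<in> P" by (auto simp: Ptilde_def)
    have "Y - (\<gamma> + \<tau> * y0) = (\<sigma> / real n ^ h) * e + (\<tau> / real m ^ h) * (y - y')"
      unfolding Y_def v(3) by (simp add: algebra_simps diff_divide_distrib)
    also have "\<bar>\<dots>\<bar> \<le> (\<bar>\<sigma>\<bar> / real n ^ h) * \<bar>e\<bar> + (\<bar>\<tau>\<bar> / real m ^ h) * \<bar>y - y'\<bar>"
      by (rule order_trans[OF abs_triangle_ineq]) (simp add: abs_mult)
    also have "\<dots> \<le> (\<bar>\<sigma>\<bar> / real n ^ h) * 1 + (\<bar>\<tau>\<bar> / real m ^ h) * 1"
      using binary_sums_bounds[OF e] n2 P_unit[OF y] P_unit[OF v(2)] by (intro add_mono mult_left_mono) auto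
    also have "\<dots> < \<epsilon>" using h by linarith
    finally have "\<bar>Y - (\<gamma> + \<tau> * y0)\<bar> < \<epsilon>" .
    then have "z < Y" "Y < z + 1" unfolding \<epsilon>_def by auto
    then have "w = z" using P_unit[OF w] by auto
    then show ?thesis using w by (simp add: Y_def algebra_simps)
  qed
  then show ?thesis using nz by (intro exI[of _ "\<gamma> + \<tau> * v - z"] exI[of _ "\<sigma> / real n ^ h"] exI[of _ "\<tau> / real m ^ h"]) auto
qed

section \<open>Intervals and oblique segments exclude missing digits\<close>

lemma reach_mod_one:
  fixes a b q :: real assumes "b \<noteq> 0"
  shows "\<exists>t (w::int). 0 \<le> t \<and> t \<le> 1 / \<bar>b\<bar> \<and> a + t * b = q + w"
proof (cases "b > 0")
  case True
  define w where "w = \<lceil>a - q\<rceil>"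
  have "0 \<le> q + w - a" "q + w - a \<le> 1" unfolding w_def by linarith+
  then have "0 \<le> (q + w - a) / b" "(q + w - a) / b \<le> 1 / \<bar>b\<bar>"
    using True by (simp_all add: divide_right_mono)
  then show ?thesis using True by (intro exI[of _ "(q + w - a) / b"] exI[of _ w]) simp
next
  case False
  define w where "w = \<lfloor>a - q\<rfloor>"
  have "0 \<le> a - (q + w)" "a - (q + w) \<le> 1" unfolding w_def by linarith+
  then have "0 \<le> (a - (q + w)) / \<bar>b\<bar>" "(a - (q + w)) / \<bar>b\<bar> \<le> 1 / \<bar>b\<bar>"
    by (simp_all add: divide_right_mono)
  then show ?thesis using False assms
    by (intro exI[of _ "(a - (q + w)) / \<bar>b\<bar>"] exI[of _ w]) (simp add: abs_if)
qed

text \<open>A magnification by a power of \<open>m\<close> stretches the interval to length at least one, so that it meets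
  the centre of the cell of row \<open>j\<close> modulo one.\<close>

lemma all_rows_if_P_contains_interval:
  assumes "u < v" "{u..v} \<subseteq> P" "j < m"
  shows "j \<in> snd ` \<Lambda>"
proof -
  obtain k where k: "1 / (v - u) / real m ^ k < 1"
    using eventually_happens'[OF sequentially_bot eventually_divide_power_less[OF m2 zero_less_one]] by blast
  define b where "b = (v - u) * real m ^ k"
  have b: "b > 0" using assms(1) by (simp add: b_def)
  define q where "q = (real j + 1 / 2) / m"
  obtain t w where t: "0 \<le> t" "t \<le> 1 / b" and w: "u * real m ^ k + t * b = q + of_int w"
    using reach_mod_one[of b "u * real m ^ k" q] b by auto
  have "1 / b \<le> 1" using k by (simp add: b_def)
  then have "t \<le> 1" using t by simp
  then have "t * (v - u) \<le> 1 * (v - u)" using assms(1) by (intro mult_right_mono) auto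
  then have "u + t * (v - u) \<le> v" by simp
  moreover have "u \<le> u + t * (v - u)" using assms(1) t(1) by simp
  ultimately have "u + t * (v - u) \<in> P" using assms(2) by auto
  from Ptilde_expand[OF P_subset_Ptilde[OF this], of k] have "q + of_int w \<in> Ptilde"
    unfolding w[symmetric] b_def by (simp add: algebra_simps)
  then show ?thesis
    by (rule Ptilde_digit[where w = w]) (use assms in \<open>auto simp: q_def field_simps\<close>)
qed

text \<open>The expansion by \<open>(n ^ k, m ^ k)\<close> makes an oblique segment long in both directions, but with slope of
  order \<open>(m / n) ^ k\<close>. It winds around the torus many times, almost horizontally, while it drifts through
  all heights, and hence comes close to the centre of the cell of \<open>(i, j)\<close>.\<close>

lemma all_digits_if_K_contains_oblique_segment:
  assumes nz: "\<alpha> \<noteq> 0" "\<beta> \<noteq> 0" and seg: "\<And>t. 0 \<le> t \<Longrightarrow> t \<le> 1 \<Longrightarrow> (x0 + t * \<alpha>, y0 + t * \<beta>) \<in> K"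
    and ij: "i < n" "j < m"
  shows "(i, j) \<in> \<Lambda>"
proof -
  have ev: "\<forall>\<^sub>F k in sequentially. 1 / \<bar>\<beta>\<bar> / real m ^ k < 1/2 \<and> 1 / \<bar>\<alpha>\<bar> / real n ^ k < 1/2 \<and> \<bar>\<beta> / \<alpha>\<bar> * (real m / real n) ^ k < 1 / (2 * m)"
    using order_tendstoD(2)[OF tendsto_mult_left[OF ratio_tendsto, of "\<bar>\<beta> / \<alpha>\<bar>"], of "1 / (2 * m)"]
    by (intro eventually_conj eventually_divide_power_less n2 m2) auto
  obtain k where k: "1 / \<bar>\<beta>\<bar> / real m ^ k < 1/2" "1 / \<bar>\<alpha>\<bar> / real n ^ k < 1/2" "\<bar>\<beta> / \<alpha>\<bar> * (real m / real n) ^ k < 1 / (2 * m)"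
    using eventually_happens'[OF sequentially_bot ev] by blast
  define a b where "a = real n ^ k * \<alpha>" and "b = real m ^ k * \<beta>"
  have ab: "a \<noteq> 0" "b \<noteq> 0" using nz by (auto simp: a_def b_def)
  define q1 q2 where "q1 = (real i + 1 / 2) / n" and "q2 = (real j + 1 / 2) / m"
  \<comment> \<open>Move along the segment first to reach the height of the centre modulo one, and then by at most
    one horizontal period, which changes the height only slightly.\<close>
  obtain t w where t: "0 \<le> t" "t \<le> 1 / \<bar>b\<bar>" and w: "real m ^ k * y0 + t * b = q2 + of_int w"
    using reach_mod_one[OF ab(2)] by blast
  obtain t' v where t': "0 \<le> t'" "t' \<le> 1 / \<bar>a\<bar>" and v: "(real n ^ k * x0 + t * a) + t' * a = q1 + of_int v"
    using reach_mod_one[OF ab(1)] by blast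
  have "1 / \<bar>b\<bar> < 1/2" "1 / \<bar>a\<bar> < 1/2" using k by (simp_all add: a_def b_def abs_mult mult.commute)
  then have "(x0 + (t + t') * \<alpha>, y0 + (t + t') * \<beta>) \<in> K" using t t' by (intro seg) auto
  from Ktilde_expand[OF K_subset_Ktilde[OF this], of k]
  have "(real n ^ k * x0 + t * a + t' * a, real m ^ k * y0 + t * b + t' * b) \<in> Ktilde"
    by (simp add: a_def b_def algebra_simps)
  then have mem: "(q1 + of_int v, q2 + of_int w + t' * b) \<in> Ktilde" using v w by (simp add: algebra_simps)
  have "\<bar>t' * b\<bar> \<le> 1 / \<bar>a\<bar> * \<bar>b\<bar>" using t' by (simp add: abs_mult mult_right_mono del: times_divide_eq_left)
  also have "\<dots> = \<bar>\<beta> / \<alpha>\<bar> * (real m / real n) ^ k" by (simp add: a_def b_def abs_mult power_divide mult.commute)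
  finally have "\<bar>t' * b\<bar> < 1 / (2 * m)" using k(3) by simp
  then have "m * \<bar>t' * b\<bar> < 1 / 2" by (simp add: field_simps)
  then have tb: "\<bar>m * (t' * b)\<bar> < 1 / 2" by (simp add: abs_mult)
  have mq: "m * (q2 + of_int w + t' * b) = m * w + j + 1 / 2 + m * (t' * b)"
    by (simp add: q2_def field_simps)
  have "m * w + j < m * (q2 + of_int w + t' * b)" "m * (q2 + of_int w + t' * b) < m * w + j + 1"
    unfolding mq using tb by auto
  moreover have "n * v + i < n * (q1 + of_int v)" "n * (q1 + of_int v) < n * v + i + 1"
    by (auto simp: q1_def field_simps)
  ultimately show ?thesis using Ktilde_digit[OF mem] ij by blast
qed

lemma P_unit_interval_if_all_rows:
  assumes "\<And>j. j < m \<Longrightarrow> j \<in> snd ` \<Lambda>"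
  shows "{0..1} \<subseteq> P"
proof -
  have "{0..1} \<subseteq> closure P"
  proof (rule subset_closure_if_digits_cover[where b = m and D = "real ` {..<m}"])
    show "1 < real m" using m2 by simp
    show "P \<noteq> {}" by (rule P_nonempty)
    show "(s + d) / m \<in> P" if s: "s \<in> P" and d: "d \<in> real ` {..<m}" for s d
    proof -
      obtain i j where "(i, j) \<in> \<Lambda>" "d = real j" using d assms by force
      then show ?thesis using P_map s by simp
    qed
    show "\<exists>d\<in>real ` {..<m}. real m * x - d \<in> {0..1}" if x: "x \<in> {0..1}" for x
    proof (cases "x = 1")
      case True
      then show ?thesis using m2 by (intro bexI[of _ "real (m - 1)"] imageI) (auto simp: of_nat_diff)
    next
      case False
      then have "m * x < m" "0 \<le> m * x" using x by auto
      then have "nat \<lfloor>m * x\<rfloor> < m" "m * x - real (nat \<lfloor>m * x\<rfloor>) \<in> {0..1}"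
        by (simp_all add: floor_less_iff nat_less_iff) linarith
      then show ?thesis by blast
    qed
  qed simp
  then show ?thesis using P_closed by simp
qed

section \<open>Horizontal slices of carpets with at most one digit per row\<close>

text \<open>If the row of a digit determines the digit, then the heights of the grid cells of level \<open>h\<close> determine
  their columns; \<open>g Y\<close> is the column of the cell at height \<open>Y\<close>.\<close>

lemma column_function_of_row:
  assumes "inj_on snd \<Lambda>"
  shows "\<exists>g::nat \<Rightarrow> real. \<forall>x y. (x, y) \<in> K \<longrightarrow>
    (\<exists>Y<m ^ h. real m ^ h * y \<in> {real Y..Y + 1} \<and> real n ^ h * x \<in> {g Y..g Y + 1})"
proof (induction h)
  case 0
  show ?case by (intro exI[of _ "\<lambda>_. 0"]) (use K_unit in auto)
next
  case (Suc h)
  then obtain g :: "nat \<Rightarrow> real" where g: "\<And>x y. (x, y) \<in> K \<Longrightarrow>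
    \<exists>Y<m ^ h. real m ^ h * y \<in> {real Y..Y + 1} \<and> real n ^ h * x \<in> {g Y..g Y + 1}" by blast
  define col where "col j = (SOME i. (i, j) \<in> \<Lambda>)" for j
  have col: "col j = i" if "(i, j) \<in> \<Lambda>" for i j
  proof -
    have "(col j, j) \<in> \<Lambda>" unfolding col_def using that by (rule someI)
    then show ?thesis using inj_onD[OF assms _ _ that, of "(col j, j)"] by simp
  qed
  define g' where "g' Z = real n ^ h * col (Z div m ^ h) + g (Z mod m ^ h)" for Z
  have "\<exists>Y<m ^ Suc h. real m ^ Suc h * y \<in> {real Y..Y + 1} \<and> real n ^ Suc h * x \<in> {g' Y..g' Y + 1}" if xy: "(x, y) \<in> K" for x y
  proof -
    obtain i j x' y' where *: "(i, j) \<in> \<Lambda>" "(x', y') \<in> K" "x = (x' + real i) / n" "y = (y' + real j) / m"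
      using xy by (rule K_unmap)
    obtain Y where Y: "Y < m ^ h" "real m ^ h * y' \<in> {real Y..Y + 1}" "real n ^ h * x' \<in> {g Y..g Y + 1}" using g[OF *(2)] by blast
    have "g' (m ^ h * j + Y) = real n ^ h * i + g Y" using Y(1) col[OF *(1)] by (simp add: g'_def)
    moreover have "real m ^ Suc h * y = real m ^ h * y' + m ^ h * j" "real n ^ Suc h * x = real n ^ h * x' + real n ^ h * i"
    proof -
      have "m * y = y' + j" "n * x = x' + i" using *(3,4) by simp_all
      then have "m ^ h * (m * y) = m ^ h * (y' + j)" "n ^ h * (n * x) = n ^ h * (x' + i)" by simp_all
      then show "real m ^ Suc h * y = real m ^ h * y' + m ^ h * j" "real n ^ Suc h * x = real n ^ h * x' + real n ^ h * i"
        by (simp_all add: algebra_simps)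
    qed
    moreover have "m ^ h * j + Y < m ^ Suc h"
    proof -
      have "m ^ h * j + Y < m ^ h * (j + 1)" using Y(1) by simp
      also have "\<dots> \<le> m ^ h * m" using digit_less(2)[OF *(1)] by (intro mult_left_mono) auto
      finally show ?thesis by (simp add: mult.commute)
    qed
    ultimately show ?thesis using Y by (intro exI[of _ "m ^ h * j + Y"]) auto
  qed
  then show ?case by blast
qed

text \<open>A given height \<open>b\<close> lies in at most two closed grid rows of level \<open>h\<close>, so among any three points of
  the slice two have the same column at level \<open>h\<close> and are within \<open>1 / n ^ h\<close> of each other. Letting
  \<open>h\<close> grow shows that a slice has at most two points.\<close>

lemma horizontal_slice_finite:
  assumes "inj_on snd \<Lambda>"
  shows "finite {x. (x, b) \<in> K}"
proof (rule ccontr)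
  assume "infinite {x. (x, b) \<in> K}"
  then obtain T where T: "T \<subseteq> {x. (x, b) \<in> K}" "card T = 3" using infinite_arbitrarily_large by blast
  then obtain x1 x2 x3 where x: "T = {x1, x2, x3}" "x1 \<noteq> x2" "x2 \<noteq> x3" "x1 \<noteq> x3" by (auto simp: card_3_iff)
  have K: "(x1, b) \<in> K" "(x2, b) \<in> K" "(x3, b) \<in> K" using T x by auto
  have ev: "\<forall>\<^sub>F h in sequentially. 1 / \<bar>x1 - x2\<bar> / real n ^ h < 1 \<and> 1 / \<bar>x2 - x3\<bar> / real n ^ h < 1 \<and> 1 / \<bar>x1 - x3\<bar> / real n ^ h < 1"
    by (intro eventually_conj eventually_divide_power_less n2) auto
  obtain h where "1 / \<bar>x1 - x2\<bar> / real n ^ h < 1" "1 / \<bar>x2 - x3\<bar> / real n ^ h < 1" "1 / \<bar>x1 - x3\<bar> / real n ^ h < 1"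
    using eventually_happens'[OF sequentially_bot ev] by blast
  then have h: "1 < real n ^ h * \<bar>x1 - x2\<bar>" "1 < real n ^ h * \<bar>x2 - x3\<bar>" "1 < real n ^ h * \<bar>x1 - x3\<bar>"
    using x by (auto simp: field_simps)
  obtain g :: "nat \<Rightarrow> real" where g: "\<And>x y. (x, y) \<in> K \<Longrightarrow>
    \<exists>Y<m ^ h. real m ^ h * y \<in> {real Y..Y + 1} \<and> real n ^ h * x \<in> {g Y..g Y + 1}" using column_function_of_row[OF assms] by metis
  obtain Y1 Y2 Y3 where Y: "real m ^ h * b \<in> {real Y1..Y1 + 1}" "real n ^ h * x1 \<in> {g Y1..g Y1 + 1}"
    "real m ^ h * b \<in> {real Y2..Y2 + 1}" "real n ^ h * x2 \<in> {g Y2..g Y2 + 1}"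
    "real m ^ h * b \<in> {real Y3..Y3 + 1}" "real n ^ h * x3 \<in> {g Y3..g Y3 + 1}"
    using g[OF K(1)] g[OF K(2)] g[OF K(3)] by blast
  have far: "Y \<noteq> Y'" if "1 < real n ^ h * \<bar>x - x'\<bar>" "real n ^ h * x \<in> {g Y..g Y + 1}" "real n ^ h * x' \<in> {g Y'..g Y' + 1}" for x x' Y Y'
  proof
    assume "Y = Y'"
    then have "\<bar>real n ^ h * x - real n ^ h * x'\<bar> \<le> 1" using that by (auto simp: abs_le_iff)
    also have "\<bar>real n ^ h * x - real n ^ h * x'\<bar> = real n ^ h * \<bar>x - x'\<bar>" by (simp add: abs_mult flip: right_diff_distrib)
    finally show False using that(1) by simp
  qed
  have "Y1 \<noteq> Y2" "Y2 \<noteq> Y3" "Y1 \<noteq> Y3" using far h Y by blast+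
  moreover have "Y \<le> Y' + 1" if "real m ^ h * b \<in> {real Y..Y + 1}" "real m ^ h * b \<in> {real Y'..Y' + 1}" for Y Y'
  proof -
    have "real Y \<le> real (Y' + 1)" using that by auto
    then show ?thesis by linarith
  qed
  then have "Y1 \<le> Y2 + 1" "Y2 \<le> Y1 + 1" "Y1 \<le> Y3 + 1" "Y3 \<le> Y1 + 1" "Y2 \<le> Y3 + 1" "Y3 \<le> Y2 + 1" using Y by blast+
  ultimately show False by linarith
qed

end

section \<open>Affine self-maps with nonzero entries\<close>

text \<open>An oblique similitude is affine with four nonzero entries in its linear part. Each entry has its
  task: \<open>q\<close> tilts vertical copies of \<open>P\<close>, \<open>p\<close> and \<open>s\<close> make horizontal segments oblique, and \<open>s\<close> and \<open>c\<close>
  mix the two coordinates of \<open>K\<close> in its projection.\<close>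

locale bedford_mcmullen_affine = bedford_mcmullen +
  fixes p q s c a\<^sub>1 a\<^sub>2 :: real
  assumes entries_nonzero: "p \<noteq> 0" "q \<noteq> 0" "s \<noteq> 0" "c \<noteq> 0"
    and maps_K: "\<And>x y. (x, y) \<in> K \<Longrightarrow> (p * x + q * y + a\<^sub>1, s * x + c * y + a\<^sub>2) \<in> K"
begin

text \<open>The second coordinate of the map sends a cylinder of level \<open>l = level k\<close> whose digits all lie in one
  row to a sum of a copy of \<open>P\<close>, of size \<open>1 / m ^ l\<close>, and a copy of \<open>binary_sums n\<close>, of size
  \<open>1 / n ^ k\<close>. The factor \<open>m ^ l\<close> brings both to bounded size, and \<open>k\<close> tends to infinity.\<close>

lemma Ptilde_absorbs:
  assumes a: "(i, j) \<in> \<Lambda>" "(i + \<delta>, j) \<in> \<Lambda>" "0 < \<delta>"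
  shows "\<exists>\<gamma> \<sigma> \<tau>. \<sigma> \<noteq> 0 \<and> \<tau> \<noteq> 0 \<and> (\<forall>e\<in>binary_sums n. \<forall>y\<in>P. \<gamma> + \<sigma> * e + \<tau> * y \<in> Ptilde)"
proof -
  define C where "C k = real m ^ level k * (s * address n i (level k) + c * address m j (level k) + a\<^sub>2)" for k
  define u where "u = (\<lambda>(e::real, x::real, y::real). s * (\<delta> * e))"
  define w where "w k = (\<lambda>(e::real, x, y). s * (real m ^ level k / real n ^ level k * x) + c * y)" for k
  have "\<exists>c' r'. r' \<in> {1 / real m..1} \<and> (\<forall>v\<in>binary_sums (real n) \<times> K. c' + r' *\<^sub>R u v + (\<lambda>(e::real, x::real, y). c * y) v \<in> Ptilde)"
  proof (rule convergent_family_limit[OF Ptilde_closed])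
    show "compact {0..1::real}" by simp
    show "C k - of_int \<lfloor>C k\<rfloor> \<in> {0..1}" for k by simp linarith
    show "real m ^ level k / real n ^ k \<in> {1 / real m..1}" for k
      using level[of k] by (auto simp: field_simps)
    show "\<forall>\<^sub>F k in sequentially. C k - of_int \<lfloor>C k\<rfloor> + (real m ^ level k / real n ^ k) *\<^sub>R u v + w k v \<in> Ptilde"
      if v: "v \<in> binary_sums (real n) \<times> K" for v
    proof -
      obtain e x y where exy: "v = (e, x, y)" "e \<in> binary_sums n" "(x, y) \<in> K" using v by auto
      obtain h where h: "\<And>k l. k + h \<le> l \<Longrightarrow> (address n i l + \<delta> * e / real n ^ k + x / real n ^ l, address m j l + y / real m ^ l) \<in> K"
        using K_address_delayed_binary_sums[OF a(1,2) exy(2)] exy(3) by blast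
      show ?thesis
        using eventually_add_le_level[of h]
      proof eventually_elim
        case (elim k)
        have "s * (address n i (level k) + \<delta> * e / real n ^ k + x / real n ^ level k) + c * (address m j (level k) + y / real m ^ level k) + a\<^sub>2 \<in> P"
          using maps_K[OF h[OF elim]] mem_P by blast
        from Ptilde_translate[OF Ptilde_expand[OF P_subset_Ptilde[OF this], of "level k"], of "\<lfloor>C k\<rfloor>"]
        show ?case
          by (rule back_subst[of "\<lambda>t. t \<in> Ptilde"]) (simp add: exy(1) C_def u_def w_def field_simps)
      qed
    qed
    show "(\<lambda>k. w k v) \<longlonglongrightarrow> (\<lambda>(e, x, y). c * y) v" for v
    proof -
      obtain e x y where v: "v = (e, x, y)" by (cases v)
      have "(\<lambda>k. s * (real m ^ level k / real n ^ level k * x) + c * y) \<longlonglongrightarrow> s * (0 * x) + c * y"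
        by (intro tendsto_intros level_ratio_tendsto)
      then show ?thesis by (simp add: v w_def)
    qed
  qed
  then obtain c' r' where r': "r' \<in> {1 / real m..1}"
    and *: "\<And>v. v \<in> binary_sums (real n) \<times> K \<Longrightarrow> c' + r' *\<^sub>R u v + (\<lambda>(e, x, y). c * y) v \<in> Ptilde" by blast
  have "1 / real m > 0" by simp
  then have "r' > 0" using r' by (simp only: atLeastAtMost_iff) linarith
  moreover have "c' + (r' * s * \<delta>) * e + c * y \<in> Ptilde" if "e \<in> binary_sums n" "y \<in> P" for e y
  proof -
    obtain x where "(x, y) \<in> K" using \<open>y \<in> P\<close> mem_P by auto
    then show ?thesis using *[of "(e, x, y)"] that(1) by (simp add: u_def mult_ac)
  qed
  moreover have "r' * s * \<delta> \<noteq> 0" using \<open>r' > 0\<close> entries_nonzero a(3) by simp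
  ultimately show ?thesis using entries_nonzero(4) by blast
qed

text \<open>A cylinder of level \<open>level k\<close> is nearly a vertical copy of \<open>P\<close>, and the map tilts it. The expansion
  by \<open>(n ^ k, m ^ k)\<close> brings its horizontal extent to bounded size, while its vertical extent, smaller by
  the factor \<open>(m / n) ^ k\<close>, vanishes in the limit. So the tilted copy turns into a horizontal one, and
  its length is proportional to the entry \<open>q\<close>.\<close>

lemma Ktilde_contains_horizontal_copy_of_P:
  "\<exists>\<sigma> b\<^sub>1 b\<^sub>2. \<sigma> \<noteq> 0 \<and> (\<forall>y\<in>P. (b\<^sub>1 + \<sigma> * y, b\<^sub>2) \<in> Ktilde)"
proof -
  obtain i j where ij: "(i, j) \<in> \<Lambda>" using digits_nonempty by auto
  define A B where "A k = address n i (level k)" and "B k = address m j (level k)" for k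
  define C1 C2 where "C1 k = real n ^ k * (p * A k + q * B k + a\<^sub>1)" and "C2 k = real m ^ k * (s * A k + c * B k + a\<^sub>2)" for k
  define C where "C k = (C1 k - of_int \<lfloor>C1 k\<rfloor>, C2 k - of_int \<lfloor>C2 k\<rfloor>)" for k
  define w where "w k = (\<lambda>(x, y). (p * (real n ^ k / real n ^ level k * x),
     s * (real m ^ k / real n ^ level k * x) + c * (real m ^ k / real m ^ level k * y)))" for k
  have "\<exists>c' r'. r' \<in> {1..real m} \<and> (\<forall>v\<in>K. c' + r' *\<^sub>R (q * snd v, 0) + (\<lambda>_. (0, 0)) v \<in> Ktilde)"
  proof (rule convergent_family_limit[OF Ktilde_closed])
    show "compact ({0..1::real} \<times> {0..1::real})" by (intro compact_Times) auto
    show "C k \<in> {0..1} \<times> {0..1}" for k unfolding C_def by simp linarith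
    show "real n ^ k / real m ^ level k \<in> {1..real m}" for k
      using level[of k] by (auto simp: field_simps)
    show "\<forall>\<^sub>F k in sequentially. C k + (real n ^ k / real m ^ level k) *\<^sub>R (q * snd v, 0) + w k v \<in> Ktilde"
      if v: "v \<in> K" for v
    proof (rule always_eventually, rule allI)
      fix k
      obtain x y where xy: "v = (x, y)" by (cases v)
      from Ktilde_translate[OF Ktilde_expand[OF K_subset_Ktilde[OF maps_K[OF K_address[OF ij v[unfolded xy], of "level k"]]], of k], of "\<lfloor>C1 k\<rfloor>" "\<lfloor>C2 k\<rfloor>"]
      show "C k + (real n ^ k / real m ^ level k) *\<^sub>R (q * snd v, 0) + w k v \<in> Ktilde"
        by (rule back_subst[of "\<lambda>t. t \<in> Ktilde"]) (simp add: xy C_def C1_def C2_def A_def B_def w_def field_simps)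
    qed
    show "(\<lambda>k. w k v) \<longlonglongrightarrow> (\<lambda>_. (0, 0)) v" for v
    proof -
      obtain x y where v: "v = (x, y)" by (cases v)
      have "(\<lambda>k. (p * (real n ^ k / real n ^ level k * x),
     s * (real m ^ k / real n ^ level k * x) + c * (real m ^ k / real m ^ level k * y))) \<longlonglongrightarrow> (p * (0 * x), s * (0 * x) + c * (0 * y))"
        by (intro tendsto_intros n_scale_tendsto mn_scale_tendsto m_scale_tendsto)
      then show ?thesis by (simp add: v w_def)
    qed
  qed
  then obtain c' r' where r': "r' \<in> {1..real m}" and *: "\<And>v. v \<in> K \<Longrightarrow> c' + r' *\<^sub>R (q * snd v, 0) + (0, 0) \<in> Ktilde" by blast
  have "(fst c' + (r' * q) * y, snd c') \<in> Ktilde" if "y \<in> P" for y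
  proof -
    obtain x where "(x, y) \<in> K" using \<open>y \<in> P\<close> mem_P by auto
    from *[OF this] show ?thesis by (cases c') (simp add: mult_ac)
  qed
  moreover have "r' * q \<noteq> 0" using entries_nonzero r' by auto
  ultimately show ?thesis by blast
qed

text \<open>The copy of \<open>P\<close> is bounded, so it meets only finitely many of the integer translates of \<open>K\<close>.\<close>

lemma K_contains_horizontal_copies_covering_P:
  "\<exists>\<sigma> F. \<sigma> \<noteq> 0 \<and> finite F \<and> (\<forall>y\<in>P. \<exists>b\<in>F. (fst b + \<sigma> * y, snd b) \<in> K)"
proof -
  obtain \<sigma> b\<^sub>1 b\<^sub>2 where \<sigma>: "\<sigma> \<noteq> 0" and b: "\<And>y. y \<in> P \<Longrightarrow> (b\<^sub>1 + \<sigma> * y, b\<^sub>2) \<in> Ktilde"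
    using Ktilde_contains_horizontal_copy_of_P by blast
  define N where "N = \<lceil>\<bar>b\<^sub>1\<bar> + \<bar>\<sigma>\<bar> + \<bar>b\<^sub>2\<bar> + 1\<rceil>"
  define F where "F = (\<lambda>(z, w). (b\<^sub>1 - of_int z, b\<^sub>2 - of_int w)) ` ({-N..N} \<times> {-N..N})"
  have "\<exists>b\<in>F. (fst b + \<sigma> * y, snd b) \<in> K" if y: "y \<in> P" for y
  proof -
    obtain z w :: int where zw: "(b\<^sub>1 + \<sigma> * y - z, b\<^sub>2 - w) \<in> K" using b[OF y] by (rule KtildeE)
    have "\<bar>\<sigma> * y\<bar> \<le> \<bar>\<sigma>\<bar> * 1" unfolding abs_mult using P_unit[OF y] by (intro mult_left_mono) auto
    moreover have "\<bar>b\<^sub>1\<bar> + \<bar>\<sigma>\<bar> + \<bar>b\<^sub>2\<bar> + 1 \<le> of_int N" unfolding N_def by (rule le_of_int_ceiling)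
    moreover have "of_int z \<le> b\<^sub>1 + \<sigma> * y" "b\<^sub>1 + \<sigma> * y \<le> of_int z + 1" "of_int w \<le> b\<^sub>2" "b\<^sub>2 \<le> of_int w + 1"
      using K_unit[OF zw] by simp_all
    ultimately have "\<bar>real_of_int z\<bar> \<le> of_int N" "\<bar>real_of_int w\<bar> \<le> of_int N" by linarith+
    then have "z \<in> {-N..N}" "w \<in> {-N..N}" by auto
    then have "(b\<^sub>1 - of_int z, b\<^sub>2 - of_int w) \<in> F" unfolding F_def by (intro image_eqI[of _ _ "(z, w)"]) auto
    then show ?thesis using zw by (intro bexI[of _ "(b\<^sub>1 - of_int z, b\<^sub>2 - of_int w)"]) (auto simp: algebra_simps)
  qed
  moreover have "finite F" unfolding F_def by simp
  ultimately show ?thesis using \<sigma> by blast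
qed

lemma not_at_most_one_digit_per_row:
  assumes "(i, j) \<in> \<Lambda>" "(i', j') \<in> \<Lambda>" "j \<noteq> j'"
  shows "\<not> inj_on snd \<Lambda>"
proof
  assume inj: "inj_on snd \<Lambda>"
  obtain \<sigma> F where F: "\<sigma> \<noteq> 0" "finite F" "\<And>y. y \<in> P \<Longrightarrow> \<exists>b\<in>F. (fst b + \<sigma> * y, snd b) \<in> K"
    using K_contains_horizontal_copies_covering_P by blast
  have "finite {y. (fst b + \<sigma> * y, snd b) \<in> K}" for b
  proof -
    have "finite ((\<lambda>y. fst b + \<sigma> * y) -` {x. (x, snd b) \<in> K})"
      using F(1) by (intro finite_vimageI horizontal_slice_finite inj) (auto intro: injI)
    then show ?thesis by (simp add: vimage_def)
  qed
  then have "finite (\<Union>b\<in>F. {y. (fst b + \<sigma> * y, snd b) \<in> K})" using F(2) by blast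
  moreover have "P \<subseteq> (\<Union>b\<in>F. {y. (fst b + \<sigma> * y, snd b) \<in> K})" using F(3) by blast
  ultimately show False using P_infinite[OF assms] finite_subset by blast
qed

text \<open>Some row has two digits, because \<open>P\<close> is infinite and otherwise all horizontal slices would be
  finite. Hence \<open>P\<close> absorbs sums with a Cantor set, so it contains an interval.\<close>

lemma all_rows:
  assumes rows: "(i, j) \<in> \<Lambda>" "(i', j') \<in> \<Lambda>" "j \<noteq> j'" and "j0 < m"
  shows "j0 \<in> snd ` \<Lambda>"
proof -
  obtain k l h where kl: "(k, h) \<in> \<Lambda>" "(l, h) \<in> \<Lambda>" "k < l"
  proof -
    obtain v w where vw: "v \<in> \<Lambda>" "w \<in> \<Lambda>" "snd v = snd w" "v \<noteq> w"
      using not_at_most_one_digit_per_row[OF rows] unfolding inj_on_def by blast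
    then have "(fst v, snd v) \<in> \<Lambda>" "(fst w, snd v) \<in> \<Lambda>" "fst v \<noteq> fst w"
      by (metis prod.collapse)+
    then show thesis using that by (meson linorder_neqE_nat)
  qed
  define \<delta> where "\<delta> = l - k"
  have "\<delta> > 0" "(k + \<delta>, h) \<in> \<Lambda>" using kl by (auto simp: \<delta>_def)
  from Ptilde_absorbs[OF kl(1) this(2,1)]
  obtain \<gamma> \<sigma> \<tau> where 1: "\<sigma> \<noteq> 0" "\<tau> \<noteq> 0" "\<And>e y. e \<in> binary_sums n \<Longrightarrow> y \<in> P \<Longrightarrow> \<gamma> + \<sigma> * e + \<tau> * y \<in> Ptilde" by blast
  from P_absorbs_if_Ptilde_absorbs[OF rows 1]
  obtain \<gamma> \<sigma> \<tau> where 2: "\<sigma> \<noteq> 0" "\<tau> \<noteq> 0" "\<And>e y. e \<in> binary_sums n \<Longrightarrow> y \<in> P \<Longrightarrow> \<gamma> + \<sigma> * e + \<tau> * y \<in> P" by blast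
  obtain u v where "u < v" "{u..v} \<subseteq> P"
    using interval_subset_if_absorbs_binary_sums[OF n2 P_closed P_nonempty 2] by blast
  then show ?thesis using all_rows_if_P_contains_interval assms(4) by blast
qed

text \<open>Once \<open>P\<close> is the unit interval, its horizontal copies in \<open>K\<close> are segments up to the finitely many
  translations, and one of the finitely many closed pieces has interior. The affine map sends the
  resulting horizontal segment of \<open>K\<close> to an oblique one.\<close>

lemma all_digits:
  assumes rows: "(i, j) \<in> \<Lambda>" "(i', j') \<in> \<Lambda>" "j \<noteq> j'"
  shows "\<Lambda> = {0..<n} \<times> {0..<m}"
proof -
  have P: "{0..1} \<subseteq> P" using P_unit_interval_if_all_rows all_rows[OF rows] by blast
  obtain \<sigma> F where F: "\<sigma> \<noteq> 0" "finite F" "\<And>y. y \<in> P \<Longrightarrow> \<exists>b\<in>F. (fst b + \<sigma> * y, snd b) \<in> K"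
    using K_contains_horizontal_copies_covering_P by blast
  define G where "G b = (\<lambda>y. (fst b + \<sigma> * y, snd b)) -` K" for b
  have closed: "closed (G b)" for b
    unfolding G_def by (intro closed_vimage compact_imp_closed K_compact continuous_intros)
  obtain b where b: "b \<in> F" "interior (G b) \<noteq> {}"
  proof (rule ccontr)
    assume "\<not> thesis"
    then have empty: "\<And>b. b \<in> F \<Longrightarrow> interior (G b) = {}" using that by blast
    have "interior (\<Union>b\<in>F. G b) = {}"
      using F(2) empty
    proof (induction F)
      case (insert b F)
      then show ?case using interior_closed_Un_empty_interior[OF closed[of b], of "\<Union>b\<in>F. G b"]
        by (simp add: Un_commute)
    qed simp
    moreover have "{0<..<1} \<subseteq> interior (\<Union>b\<in>F. G b)"
    proof (rule interior_maximal)
      show "{0<..<1} \<subseteq> (\<Union>b\<in>F. G b)"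
      proof
        fix y :: real assume "y \<in> {0<..<1}"
        then have "y \<in> P" using P by auto
        then show "y \<in> (\<Union>b\<in>F. G b)" using F(3) by (auto simp: G_def)
      qed
    qed simp
    moreover have "(1/2 :: real) \<in> {0<..<1}" by simp
    ultimately show False by blast
  qed
  obtain y0 where "y0 \<in> interior (G b)" using b by auto
  then obtain \<epsilon> where \<epsilon>: "\<epsilon> > 0" "cball y0 \<epsilon> \<subseteq> G b" by (auto simp: mem_interior_cball)
  have seg: "(fst b + \<sigma> * (y0 + t * \<epsilon>), snd b) \<in> K" if "0 \<le> t" "t \<le> 1" for t
  proof -
    have "\<bar>t * \<epsilon>\<bar> \<le> 1 * \<epsilon>" unfolding abs_mult using that \<epsilon>(1) by (intro mult_mono) auto
    then have "y0 + t * \<epsilon> \<in> cball y0 \<epsilon>" by (simp add: dist_real_def)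
    then show ?thesis using \<epsilon>(2) by (auto simp: G_def)
  qed
  define x' y' where "x' = p * (fst b + \<sigma> * y0) + q * snd b + a\<^sub>1" and "y' = s * (fst b + \<sigma> * y0) + c * snd b + a\<^sub>2"
  have oblique: "(x' + t * (p * \<sigma> * \<epsilon>), y' + t * (s * \<sigma> * \<epsilon>)) \<in> K" if "0 \<le> t" "t \<le> 1" for t
    using maps_K[OF seg[OF that]] by (simp add: x'_def y'_def algebra_simps)
  have "(k, l) \<in> \<Lambda>" if "k < n" "l < m" for k l
    by (rule all_digits_if_K_contains_oblique_segment[OF _ _ oblique that]) (use F(1) \<epsilon>(1) entries_nonzero in auto)
  then show ?thesis using digits by auto
qed

end

section \<open>Oblique similitudes\<close>

text \<open>That the image of the horizontal axis is oblique says that both entries of the first column of the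
  linear part are nonzero. The second column is orthogonal to it and nonzero, so it has no zero entry
  either.\<close>

lemma oblique_similitude_coordinates:
  assumes "oblique_similitude f"
  shows "\<exists>p q s c a\<^sub>1 a\<^sub>2. p \<noteq> 0 \<and> q \<noteq> 0 \<and> s \<noteq> 0 \<and> c \<noteq> 0 \<and>
    (\<forall>x y. f (x, y) = (p * x + q * y + a\<^sub>1, s * x + c * y + a\<^sub>2))"
proof -
  obtain r T a where r: "r > 0" and T: "orthogonal_transformation T" and f: "\<And>x. f x = r *\<^sub>R T x + a"
    and obl: "oblique_line (f ` x_axis)"
    using assms unfolding oblique_similitude_def similitude_with_ratio_def by blast
  have lin: "linear T" using T by (rule orthogonal_transformation_linear)
  obtain p s where ps: "T (1, 0) = (p, s)" by fastforce
  obtain q c where qc: "T (0, 1) = (q, c)" by fastforce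
  have "T (x, y) = (p * x + q * y, s * x + c * y)" for x y
  proof -
    have "T (x, y) = T (x *\<^sub>R (1, 0) + y *\<^sub>R (0, 1))" by simp
    also have "\<dots> = x *\<^sub>R (p, s) + y *\<^sub>R (q, c)"
      by (simp only: linear_add[OF lin] linear_scale[OF lin] ps qc)
    finally show ?thesis by (simp add: algebra_simps)
  qed
  then have fxy: "f (x, y) = (r * p * x + r * q * y + fst a, r * s * x + r * c * y + snd a)" for x y
    by (cases a) (simp add: f algebra_simps)
  have inner: "T v \<bullet> T w = v \<bullet> w" for v w using T unfolding orthogonal_transformation_def by blast
  have unit: "p\<^sup>2 + s\<^sup>2 = 1" "q\<^sup>2 + c\<^sup>2 = 1" "p * q + s * c = 0"
    using inner[of "(1, 0)" "(1, 0)"] inner[of "(0, 1)" "(0, 1)"] inner[of "(1, 0)" "(0, 1)"]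
    by (simp_all add: ps qc power2_eq_square)
  have axes: "z \<in> x_axis \<longleftrightarrow> snd z = 0" "z \<in> y_axis \<longleftrightarrow> fst z = 0" for z
    by (simp_all add: x_axis_def y_axis_def)
  have img: "f ` x_axis = {(r * p * x + fst a, r * s * x + snd a) | x. True}"
  proof -
    have "x_axis = range (\<lambda>x. (x, 0))" by (auto simp: x_axis_def)
    then have "f ` x_axis = f ` range (\<lambda>x. (x, 0))" by (rule arg_cong)
    also have "\<dots> = range (\<lambda>x. f (x, 0))" by (rule image_image)
    finally have "f ` x_axis = range (\<lambda>x. f (x, 0))" .
    then show ?thesis by (simp add: fxy full_SetCompr_eq)
  qed
  have "s \<noteq> 0"
  proof
    assume s: "s = 0"
    then have "p \<noteq> 0" using unit by auto
    have "affine_parallel (f ` x_axis) x_axis"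
      unfolding affine_parallel_def
    proof (intro exI[of _ "(0, - snd a)"] equalityI subsetI)
      fix z assume "z \<in> x_axis"
      then have "z = (0, - snd a) + (r * p * ((fst z - fst a) / (r * p)) + fst a, r * s * ((fst z - fst a) / (r * p)) + snd a)"
        using r \<open>p \<noteq> 0\<close> by (auto simp: x_axis_def s prod_eq_iff)
      then show "z \<in> (+) (0, - snd a) ` f ` x_axis" unfolding img by blast
    qed (auto simp: img s axes)
    then show False using obl by (simp add: oblique_line_def)
  qed
  moreover have "p \<noteq> 0"
  proof
    assume p: "p = 0"
    have "affine_parallel (f ` x_axis) y_axis"
      unfolding affine_parallel_def
    proof (intro exI[of _ "(- fst a, 0)"] equalityI subsetI)
      fix z assume "z \<in> y_axis"
      then have "z = (- fst a, 0) + (r * p * ((snd z - snd a) / (r * s)) + fst a, r * s * ((snd z - snd a) / (r * s)) + snd a)"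
        using r \<open>s \<noteq> 0\<close> by (auto simp: y_axis_def p prod_eq_iff)
      then show "z \<in> (+) (- fst a, 0) ` f ` x_axis" unfolding img by blast
    qed (auto simp: img p axes)
    then show False using obl by (simp add: oblique_line_def)
  qed
  moreover have "q \<noteq> 0" "c \<noteq> 0" using unit(2,3) calculation by auto
  ultimately have "r * p \<noteq> 0" "r * q \<noteq> 0" "r * s \<noteq> 0" "r * c \<noteq> 0" using r by auto
  then show ?thesis using fxy by blast
qed

theorem theorem1p4:
  fixes n m :: nat and \<Lambda> :: "(nat \<times> nat) set" and f :: "real \<times> real \<Rightarrow> real \<times> real"
  assumes "n > m" and "m \<ge> 2"
    and "\<Lambda> \<subseteq> {0..<n} \<times> {0..<m}"
    and "1 < card \<Lambda>" and "card \<Lambda> < m * n"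
    and "\<not> (\<exists>L. is_line L \<and> carpet n m \<Lambda> \<subseteq> L)"
    and "similitude f"
    and "f ` carpet n m \<Lambda> \<subseteq> carpet n m \<Lambda>"
  shows "\<not> oblique_similitude f"
proof
  assume "oblique_similitude f"
  then obtain p q s c a1 a2 where nz: "p \<noteq> 0" "q \<noteq> 0" "s \<noteq> 0" "c \<noteq> 0"
    and f: "\<And>x y. f (x, y) = (p * x + q * y + a1, s * x + c * y + a2)"
    using oblique_similitude_coordinates by blast
  interpret bedford_mcmullen n m \<Lambda>
    using assms(1-4) by unfold_locales auto
  interpret bedford_mcmullen_affine n m \<Lambda> p q s c a1 a2
    using nz assms(8) f by unfold_locales (force simp: K_def)+
  obtain i j i' j' where "(i, j) \<in> \<Lambda>" "(i', j') \<in> \<Lambda>" "j \<noteq> j'"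
    using K_in_line_if_one_row assms(6) unfolding K_def by blast
  then have "\<Lambda> = {0..<n} \<times> {0..<m}" by (rule all_digits)
  then have "card \<Lambda> = n * m" by (simp add: card_cartesian_product)
  then show False using assms(5) by simp
qed

end
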